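(* $$\mathrm{P}^{\mathrm{NP}[1]}\subseteq \mathrm{R}^{\mathcal{SN}}_{1\text{-}tt}(\mathrm{NP})\subseteq \mathrm{DP}.$$
   Context: All sets are subsets of $\Sigma^*$ with $\Sigma=\{0,1\}$; $\chi_B$ is the characteristic function of $B$. $\mathrm{NPSV}_{\rm t}$ is the class of total functions $f$ for which there is a nondeterministic polynomial-time Turing machine $N$ such that, on each input $x$, $N(x)$ has at least one accepting path, and every accepting path of $N(x)$ outputs $f(x)$ (rejecting paths have no output). $L \leq^{\mathcal{SN}}_{1\text{-}tt} B$ means: there is a function in $\mathrm{NPSV}_{\rm t}$ that on each input $x$ computes a string $y$ and a predicate $\alpha$ of one boolean variable such that $x\in L\iff\alpha(\chi_B(y))$. $\mathrm{R}^{\mathcal{SN}}_{1\text{-}tt}(\mathrm{NP})=\{L\mid(\exists B\in\mathrm{NP})[L\leq^{\mathcal{SN}}_{1\text{-}tt}B]\}$. $\mathrm{P}^{\mathrm{NP}[1]}$ is the class of languages decidable by a deterministic polynomial-time oracle Turing machine making at most one query to a set in $\mathrm{NP}$. $\mathrm{DP}=\{L_1-L_2\mid L_1,L_2\in\mathrm{NP}\}$. *)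

theory Defs
  imports "HOL-Computational_Algebra.Polynomial"
begin

text \<open>
  Strings over $\{0,1\}$ are boolean lists, with \<open>False\<close> for 0 and \<open>True\<close> for 1.
\<close>

type_synonym language = "bool list set"


subsection \<open>Nondeterministic multi-tape Turing machines\<close>

datatype sym = Blank | Bit bool | Aux nat

datatype dir = MoveL | Stay | MoveR

text \<open>
  A tape is infinite in both directions; it is given by its contents and the head position.
\<close>

type_synonym tape = "(int \<Rightarrow> sym) \<times> int"

type_synonym config = "nat \<times> tape list"

text \<open>
  A transition \<open>(q, rs, q', ws)\<close> is applicable in state \<open>q\<close> when the heads scan the symbols
  \<open>rs\<close> (one per tape); the machine enters state \<open>q'\<close> and \<open>ws\<close> says, for each tape, what to
  write and where to move.  States are taken from \<open>nat\<close> and work symbols from \<open>Aux\<close>, so that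
  one can quantify over all machines; the sets actually used are finite (see \<open>wf_tm\<close>).
\<close>

record tm =
  tapes :: nat
  states :: "nat set"
  alphabet :: "sym set"
  start :: nat
  accepting :: "nat set"
  trans :: "(nat \<times> sym list \<times> nat \<times> (sym \<times> dir) list) set"

definition wf_tm :: "'a tm_scheme \<Rightarrow> bool" where
  "wf_tm M \<longleftrightarrow>
     tapes M \<ge> 1 \<and>
     finite (states M) \<and> finite (alphabet M) \<and>
     {Blank, Bit False, Bit True} \<subseteq> alphabet M \<and>
     start M \<in> states M \<and> accepting M \<subseteq> states M \<and>
     (\<forall>(q, rs, q', ws) \<in> trans M.
        q \<in> states M - accepting M \<and> q' \<in> states M \<and>
        length rs = tapes M \<and> set rs \<subseteq> alphabet M \<and>
        length ws = tapes M \<and> fst ` set ws \<subseteq> alphabet M)"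

fun offset :: "dir \<Rightarrow> int" where
  "offset MoveL = -1"
| "offset Stay = 0"
| "offset MoveR = 1"

fun scan :: "tape \<Rightarrow> sym" where
  "scan (t, h) = t h"

fun act :: "sym \<times> dir \<Rightarrow> tape \<Rightarrow> tape" where
  "act (a, d) (t, h) = (t(h := a), h + offset d)"

definition step :: "'a tm_scheme \<Rightarrow> (config \<times> config) set" where
  "step M = {((q, ts), (q', map2 act ws ts)) | q ts q' ws.
               (q, map scan ts, q', ws) \<in> trans M}"

definition blank_tape :: tape where
  "blank_tape = (\<lambda>_. Blank, 0)"

definition input_tape :: "bool list \<Rightarrow> tape" where
  "input_tape x =
     (\<lambda>i. if 0 \<le> i \<and> i < int (length x) then Bit (x ! nat i) else Blank, 0)"

definition init :: "'a tm_scheme \<Rightarrow> bool list \<Rightarrow> config" where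
  "init M x = (start M, input_tape x # replicate (tapes M - 1) blank_tape)"

text \<open>
  The string held by a tape is the maximal block of bits starting at the head and extending
  to the right.  (The block is finite on every tape that arises in a computation.)
  Machines output strings, and pose oracle queries, on their last tape.
\<close>

fun tape_word :: "tape \<Rightarrow> bool list" where
  "tape_word (t, h) =
     map (\<lambda>i. t (h + int i) = Bit True) [0 ..< (LEAST n. t (h + int n) \<notin> range Bit)]"

definition output_word :: "config \<Rightarrow> bool list" where
  "output_word c = tape_word (last (snd c))"

text \<open>
  A computation path ends when no transition applies, so by \<open>wf_tm\<close> accepting states are
  halting; a path that ends in any other state rejects.
\<close>

definition accepting_configs :: "'a tm_scheme \<Rightarrow> bool list \<Rightarrow> config set" where
  "accepting_configs M x = {c. (init M x, c) \<in> (step M)\<^sup>* \<and> fst c \<in> accepting M}"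

definition poly_time :: "'a tm_scheme \<Rightarrow> bool" where
  "poly_time M \<longleftrightarrow>
     (\<exists>p :: nat poly. \<forall>x n c. (init M x, c) \<in> step M ^^ n \<longrightarrow> n \<le> poly p (length x))"


subsection \<open>NP, DP and total single-valued nondeterministic functions\<close>

definition NP :: "language set" where
  "NP = {L. \<exists>M :: tm. wf_tm M \<and> poly_time M \<and>
              (\<forall>x. x \<in> L \<longleftrightarrow> accepting_configs M x \<noteq> {})}"

definition DP :: "language set" where
  "DP = {L1 - L2 | L1 L2. L1 \<in> NP \<and> L2 \<in> NP}"

definition NPSV_t :: "(bool list \<Rightarrow> bool list) set" where
  "NPSV_t = {f. \<exists>M :: tm. wf_tm M \<and> poly_time M \<and>
                  (\<forall>x. accepting_configs M x \<noteq> {} \<and>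
                       (\<forall>c \<in> accepting_configs M x. output_word c = f x))}"


subsection \<open>Strong nondeterministic 1-truth-table reductions\<close>

text \<open>
  A string \<open>y\<close> and a predicate \<open>\<alpha>\<close> of one boolean variable are coded as one string, the truth
  table of \<open>\<alpha>\<close> followed by \<open>y\<close>.
\<close>

definition encode_query :: "bool list \<Rightarrow> (bool \<Rightarrow> bool) \<Rightarrow> bool list" where
  "encode_query y \<alpha> = \<alpha> False # \<alpha> True # y"

definition SN_1tt_reducible :: "language \<Rightarrow> language \<Rightarrow> bool" where
  "SN_1tt_reducible L B \<longleftrightarrow>
     (\<exists>f \<in> NPSV_t. \<forall>x. \<exists>y \<alpha>. f x = encode_query y \<alpha> \<and> (x \<in> L \<longleftrightarrow> \<alpha> (y \<in> B)))"

definition R_SN_1tt :: "language set \<Rightarrow> language set" where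
  "R_SN_1tt C = {L. \<exists>B \<in> C. SN_1tt_reducible L B}"


subsection \<open>Deterministic oracle machines\<close>

record oracle_tm = tm +
  query_state :: nat
  yes_state :: nat
  no_state :: nat

definition deterministic :: "'a tm_scheme \<Rightarrow> bool" where
  "deterministic M \<longleftrightarrow>
     (\<forall>q rs a b. (q, rs, a) \<in> trans M \<longrightarrow> (q, rs, b) \<in> trans M \<longrightarrow> a = b)"

text \<open>The query state is left only through the oracle.\<close>

definition wf_oracle_tm :: "oracle_tm \<Rightarrow> bool" where
  "wf_oracle_tm M \<longleftrightarrow>
     wf_tm M \<and> {query_state M, yes_state M, no_state M} \<subseteq> states M \<and>
     query_state M \<notin> accepting M \<and> query_state M \<notin> fst ` trans M"

definition oracle_step :: "oracle_tm \<Rightarrow> language \<Rightarrow> (config \<times> config) set" where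
  "oracle_step M B =
     step M \<union>
     {((query_state M, ts), (if tape_word (last ts) \<in> B then yes_state M else no_state M, ts)) | ts.
        True}"

definition oracle_accepts :: "oracle_tm \<Rightarrow> language \<Rightarrow> bool list \<Rightarrow> bool" where
  "oracle_accepts M B x \<longleftrightarrow>
     (\<exists>c. (init M x, c) \<in> (oracle_step M B)\<^sup>* \<and> fst c \<in> accepting M)"

text \<open>
  As usual for polynomial-time oracle machines, the time bound does not depend on the oracle.
\<close>

definition oracle_poly_time :: "oracle_tm \<Rightarrow> bool" where
  "oracle_poly_time M \<longleftrightarrow>
     (\<exists>p :: nat poly. \<forall>B x n c.
        (init M x, c) \<in> oracle_step M B ^^ n \<longrightarrow> n \<le> poly p (length x))"

text \<open>The points in time at which the computation with oracle \<open>B\<close> poses a query.\<close>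

definition query_times :: "oracle_tm \<Rightarrow> language \<Rightarrow> bool list \<Rightarrow> nat set" where
  "query_times M B x = {n. \<exists>ts. (init M x, (query_state M, ts)) \<in> oracle_step M B ^^ n}"

text \<open>\<open>P_one_query C\<close> is $\mathrm{P}^{C[1]}$.\<close>

definition P_one_query :: "language set \<Rightarrow> language set" where
  "P_one_query C = {L. \<exists>B \<in> C. \<exists>M.
     wf_oracle_tm M \<and> deterministic M \<and> oracle_poly_time M \<and>
     (\<forall>x. finite (query_times M B x) \<and> card (query_times M B x) \<le> 1) \<and>
     (\<forall>x. x \<in> L \<longleftrightarrow> oracle_accepts M B x)}"

end

theory Submission
  imports Defs
begin

text \<open>
  For the first inclusion, let \<open>M\<close> be an oracle machine that poses at most one query.  Answering
  all queries of \<open>M\<close> by ``no'' or all by ``yes'' gives two deterministic machines without oracle,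
  whose verdicts are the truth table \<open>\<alpha>\<close>; halting at the first query gives the query word \<open>y\<close>.
  If there is no query, both verdicts agree and any \<open>y\<close> will do.  Halting in a query state leaves
  \<open>y\<close> at the head of the last tape, so the two bits only have to be written to its left.

  For the second inclusion, if \<open>f x\<close> is \<open>\<alpha> False\<close>, \<open>\<alpha> True\<close>, \<open>y\<close>, then \<open>x \<in> L\<close> iff
  (\<open>\<alpha> False\<close>, or \<open>\<alpha> True\<close> and \<open>y \<in> B\<close>) and not (\<open>\<not> \<alpha> True\<close> and \<open>y \<in> B\<close>); both conditions are
  in NP because an accepting path of the machine for \<open>f\<close> produces the true value of \<open>f x\<close>.
\<close>


section \<open>Machines on tape lists\<close>

text \<open>The obstacle is that machines are concrete transition tables, while the argument needs
  them chained, branched and run side by side. The proof therefore works with an exact semantics of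
  nondeterministic programs: since the set of possible final tape lists is known exactly and
  rejection is the empty set, the existence of an accepting path and the agreement of all outputs
  are read off from the same equation. The machines with fixed answers may leave every path that
  occurs with the true oracle, and may then query many times. They still run in polynomial time
  because the bound of an oracle machine holds for every oracle, in particular for the empty and the
  full one. Being deterministic and halting, they can also be complemented. The machine for
  \<open>B\<close> cannot, so a condition that \<open>y\<close> lies outside \<open>B\<close> has to
  be expressed by subtracting an NP set, which is what DP allows.\<close>

lemma poly_nat_mono:
  fixes p :: "nat poly"
  assumes "m \<le> n"
  shows "poly p m \<le> poly p n"
  by (induction p) (auto intro!: add_mono mult_mono assms)

text \<open>One window serves for the head and for the nonblank cells, so a step enlarges it by at
  most one cell on each side. It makes the words on tapes finite and bounds their length in terms of
  the steps made.\<close>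

definition confined :: "nat \<Rightarrow> tape \<Rightarrow> bool" where
  "confined n t \<longleftrightarrow> \<bar>snd t\<bar> \<le> int n \<and> (\<forall>i. int n < \<bar>i\<bar> \<longrightarrow> fst t i = Blank)"

definition tapes_ok :: "nat \<Rightarrow> sym set \<Rightarrow> nat \<Rightarrow> tape list \<Rightarrow> bool" where
  "tapes_ok k \<Gamma> n ts \<longleftrightarrow>
     length ts = k \<and> (\<forall>t \<in> set ts. range (fst t) \<subseteq> \<Gamma> \<and> confined n t)"

lemma confined_mono: "confined m t \<Longrightarrow> m \<le> n \<Longrightarrow> confined n t"
  unfolding confined_def by fastforce

lemma tapes_ok_mono: "tapes_ok k \<Gamma> m ts \<Longrightarrow> m \<le> n \<Longrightarrow> tapes_ok k \<Gamma> n ts"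
  unfolding tapes_ok_def using confined_mono by blast

lemma tapes_ok_length: "tapes_ok k \<Gamma> n ts \<Longrightarrow> length ts = k"
  by (simp add: tapes_ok_def)

lemma scan_eq: "scan t = fst t (snd t)"
  by (cases t) simp

lemma act_eq: "act a t = ((fst t)(snd t := fst a), snd t + offset (snd a))"
  by (cases t; cases a) simp

lemma act_scan: "act (scan t, d) t = (fst t, snd t + offset d)"
  by (simp add: act_eq scan_eq)

lemma act_scan_Stay [simp]: "act (scan t, Stay) t = t"
  by (simp add: act_scan)

lemma tapes_ok_scan: "tapes_ok k \<Gamma> n ts \<Longrightarrow> scan ` set ts \<subseteq> \<Gamma>"
  unfolding tapes_ok_def scan_eq by blast

lemma abs_offset: "\<bar>offset d\<bar> \<le> 1"
  by (cases d) auto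

lemma confined_act: "confined n t \<Longrightarrow> confined (Suc n) (act a t)"
  using abs_offset[of "snd a"] unfolding confined_def act_eq by auto

lemma tapes_ok_act:
  assumes "tapes_ok k \<Gamma> n ts" "length ws = k" "fst ` set ws \<subseteq> \<Gamma>"
  shows "tapes_ok k \<Gamma> (Suc n) (map2 act ws ts)"
proof -
  have "range (fst (act a t)) \<subseteq> \<Gamma> \<and> confined (Suc n) (act a t)"
    if "(a, t) \<in> set (zip ws ts)" for a t
  proof -
    have "a \<in> set ws" "t \<in> set ts"
      using that by (auto dest: set_zip_leftD set_zip_rightD)
    then show ?thesis
      using assms confined_act[of n t a] unfolding tapes_ok_def
      by (auto simp: act_eq image_subset_iff)
  qed
  then have "\<forall>t' \<in> (\<lambda>(a, t). act a t) ` set (zip ws ts). range (fst t') \<subseteq> \<Gamma> \<and> confined (Suc n) t'"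
    by (metis (no_types, lifting) case_prod_conv imageE surj_pair)
  with assms(1,2) show ?thesis
    by (simp add: tapes_ok_def)
qed

definition keep :: "sym list \<Rightarrow> (sym \<times> dir) list" where
  "keep rs = map (\<lambda>s. (s, Stay)) rs"

lemma length_keep [simp]: "length (keep rs) = length rs"
  by (simp add: keep_def)

lemma fst_set_keep [simp]: "fst ` set (keep rs) = set rs"
  by (force simp: keep_def)

lemma act_keep [simp]: "map2 act (keep (map scan ts)) ts = ts"
  by (induction ts) (auto simp: keep_def)

text \<open>As a function of the transition table alone, the step relation turns unions of tables
  into unions of relations; this is how the machines built below are analysed.\<close>

definition steps :: "(nat \<times> sym list \<times> nat \<times> (sym \<times> dir) list) set \<Rightarrow> (config \<times> config) set" where
  "steps T = {((q, ts), (q', map2 act ws ts)) | q ts q' ws. (q, map scan ts, q', ws) \<in> T}"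

lemma step_eq_steps: "step M = steps (trans M)"
  by (simp add: step_def steps_def)

lemma steps_Un: "steps (S \<union> T) = steps S \<union> steps T"
  by (auto simp: steps_def)

lemma steps_iff:
  "((q, ts), c) \<in> steps T \<longleftrightarrow> (\<exists>q' ws. (q, map scan ts, q', ws) \<in> T \<and> c = (q', map2 act ws ts))"
  by (auto simp: steps_def)

text \<open>Transition tables have no wildcards, so an unconditional change of state needs one entry
  per tuple of scanned symbols. Only symbols of \<open>\<Gamma>\<close> are covered, which is why
  reachable tapes have to be shown to stay within the alphabet.\<close>

definition jumps ::
    "nat set \<Rightarrow> sym set \<Rightarrow> nat \<Rightarrow> nat \<Rightarrow> (nat \<times> sym list \<times> nat \<times> (sym \<times> dir) list) set" where
  "jumps Q \<Gamma> k s = {(q, rs, s, keep rs) | q rs. q \<in> Q \<and> length rs = k \<and> set rs \<subseteq> \<Gamma>}"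

lemma steps_jumps:
  "((q, ts), c) \<in> steps (jumps Q \<Gamma> k s) \<longleftrightarrow>
     q \<in> Q \<and> length ts = k \<and> scan ` set ts \<subseteq> \<Gamma> \<and> c = (s, ts)"
  by (auto simp: steps_iff jumps_def)

lemma wf_transD:
  assumes "wf_tm M" "(q, rs, q', ws) \<in> trans M"
  shows "q \<in> states M" "q \<notin> accepting M" "q' \<in> states M" "length rs = tapes M"
    "set rs \<subseteq> alphabet M" "length ws = tapes M" "fst ` set ws \<subseteq> alphabet M"
proof -
  have "\<forall>t \<in> trans M. case t of (q, rs, q', ws) \<Rightarrow>
      q \<in> states M - accepting M \<and> q' \<in> states M \<and> length rs = tapes M \<and>
      set rs \<subseteq> alphabet M \<and> length ws = tapes M \<and> fst ` set ws \<subseteq> alphabet M"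
    using assms(1) by (simp add: wf_tm_def)
  from bspec[OF this assms(2)]
  show "q \<in> states M" "q \<notin> accepting M" "q' \<in> states M" "length rs = tapes M"
    "set rs \<subseteq> alphabet M" "length ws = tapes M" "fst ` set ws \<subseteq> alphabet M"
    by simp_all
qed

lemma wf_tmI:
  assumes "1 \<le> tapes M" "finite (states M)" "finite (alphabet M)"
    "{Blank, Bit False, Bit True} \<subseteq> alphabet M" "start M \<in> states M"
    "accepting M \<subseteq> states M"
    and trans: "\<And>q rs q' ws. (q, rs, q', ws) \<in> trans M \<Longrightarrow>
      q \<in> states M - accepting M \<and> q' \<in> states M \<and> length rs = tapes M \<and>
      set rs \<subseteq> alphabet M \<and> length ws = tapes M \<and> fst ` set ws \<subseteq> alphabet M"
  shows "wf_tm M"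
proof -
  have "case t of (q, rs, q', ws) \<Rightarrow>
      q \<in> states M - accepting M \<and> q' \<in> states M \<and> length rs = tapes M \<and>
      set rs \<subseteq> alphabet M \<and> length ws = tapes M \<and> fst ` set ws \<subseteq> alphabet M"
    if "t \<in> trans M" for t
    using trans that by (cases t) blast
  then show ?thesis unfolding wf_tm_def by (intro conjI ballI assms(1-6))
qed

lemma wf_stepD:
  assumes "wf_tm M" "(c, c') \<in> step M"
  shows "fst c \<in> states M" "fst c \<notin> accepting M" "fst c' \<in> states M"
  using assms wf_transD[OF assms(1)] unfolding step_def by auto

lemma wf_start: "wf_tm M \<Longrightarrow> start M \<in> states M"
  by (simp add: wf_tm_def)

lemma wf_relpow_states:
  assumes "wf_tm M" "((start M, ts), c) \<in> step M ^^ n"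
  shows "fst c \<in> states M"
  using assms(2)
  by (cases n) (auto simp: wf_start assms(1) dest: wf_stepD(3)[OF assms(1)])

lemma tapes_ok_step:
  assumes "wf_tm M" "(c, c') \<in> step M" "tapes_ok (tapes M) (alphabet M) n (snd c)"
  shows "tapes_ok (tapes M) (alphabet M) (Suc n) (snd c')"
  using assms(2,3) wf_transD[OF assms(1)] tapes_ok_act unfolding step_def by force

lemma tapes_ok_relpow:
  assumes "wf_tm M" "(c, c') \<in> step M ^^ m" "tapes_ok (tapes M) (alphabet M) n (snd c)"
  shows "tapes_ok (tapes M) (alphabet M) (n + m) (snd c')"
  using assms(2)
proof (induction m arbitrary: c')
  case 0
  then show ?case using assms(3) by auto
next
  case (Suc m)
  then obtain d where d: "(c, d) \<in> step M ^^ m" "(d, c') \<in> step M" by auto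
  then show ?case using tapes_ok_step[OF assms(1) d(2)] Suc.IH[OF d(1)] by simp
qed

lemma tapes_ok_rtrancl:
  assumes "wf_tm M" "(c, c') \<in> (step M)\<^sup>*" "tapes_ok (tapes M) (alphabet M) n (snd c)"
  obtains m where "tapes_ok (tapes M) (alphabet M) m (snd c')"
  using tapes_ok_relpow[OF assms(1) _ assms(3)] assms(2) by (meson rtrancl_imp_relpow)

text \<open>The accepting state is forgotten, so that only tapes are passed on from one program to
  the next; the empty set means that no path accepts.\<close>

definition results :: "'a tm_scheme \<Rightarrow> tape list \<Rightarrow> tape list set" where
  "results M ts = {ts'. \<exists>q \<in> accepting M. ((start M, ts), (q, ts')) \<in> (step M)\<^sup>*}"

definition halts_within :: "'a tm_scheme \<Rightarrow> tape list \<Rightarrow> nat \<Rightarrow> bool" where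
  "halts_within M ts N \<longleftrightarrow> (\<forall>n c. ((start M, ts), c) \<in> step M ^^ n \<longrightarrow> n \<le> N)"

lemma halts_within_mono: "halts_within M ts m \<Longrightarrow> m \<le> n \<Longrightarrow> halts_within M ts n"
  unfolding halts_within_def by (meson le_trans)

definition initial :: "nat \<Rightarrow> bool list \<Rightarrow> tape list" where
  "initial k x = input_tape x # replicate (k - 1) blank_tape"

lemma init_eq: "init M x = (start M, initial (tapes M) x)"
  by (simp add: init_def initial_def)

lemma snd_accepting_configs:
  "snd ` accepting_configs M x = results M (initial (tapes M) x)"
  by (force simp: accepting_configs_def results_def init_eq)

lemma poly_time_iff:
  "poly_time M \<longleftrightarrow> (\<exists>p. \<forall>x. halts_within M (initial (tapes M) x) (poly p (length x)))"
  by (simp add: poly_time_def halts_within_def init_eq)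

lemma confined_input_tape: "length x \<le> n \<Longrightarrow> confined n (input_tape x)"
  by (auto simp: confined_def input_tape_def)

lemma confined_blank_tape: "confined n blank_tape"
  by (simp add: confined_def blank_tape_def)

lemma range_input_tape: "{Blank, Bit False, Bit True} \<subseteq> \<Gamma> \<Longrightarrow> range (fst (input_tape x)) \<subseteq> \<Gamma>"
  by (auto simp: input_tape_def) (metis (full_types))

lemma range_blank_tape: "{Blank, Bit False, Bit True} \<subseteq> \<Gamma> \<Longrightarrow> range (fst blank_tape) \<subseteq> \<Gamma>"
  by (auto simp: blank_tape_def)

lemma tapes_ok_initial:
  "{Blank, Bit False, Bit True} \<subseteq> \<Gamma> \<Longrightarrow> 1 \<le> k \<Longrightarrow> tapes_ok k \<Gamma> (length x) (initial k x)"
  using confined_input_tape[of x "length x"] confined_blank_tape range_input_tape range_blank_tape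
  by (auto simp: tapes_ok_def initial_def)


section \<open>Families of tape lists\<close>

text \<open>
  A family collects, for each input of the overall machine, the tape contents possible at one
  point of the program; \<open>runs\<close> says that a polynomial-time program leads from one family to
  another.  Time and space are measured in terms of the overall input throughout, so that
  sequential composition only adds time bounds.
\<close>

type_synonym family = "bool list \<Rightarrow> tape list set"

definition admissible :: "nat \<Rightarrow> sym set \<Rightarrow> family \<Rightarrow> bool" where
  "admissible k \<Gamma> A \<longleftrightarrow>
     (\<exists>p :: nat poly. \<forall>x. \<forall>ts \<in> A x. tapes_ok k \<Gamma> (poly p (length x)) ts)"

text \<open>The equality in the last clause serves two purposes: one half provides accepting paths,
  the other excludes wrong outputs. Tape count and alphabet are prescribed so that programs can be
  composed.\<close>

definition implements :: "tm \<Rightarrow> nat \<Rightarrow> sym set \<Rightarrow> family \<Rightarrow> family \<Rightarrow> bool" where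
  "implements M k \<Gamma> A B \<longleftrightarrow>
     wf_tm M \<and> tapes M = k \<and> alphabet M = \<Gamma> \<and>
     (\<exists>p. \<forall>x. \<forall>ts \<in> A x. halts_within M ts (poly p (length x))) \<and>
     (\<forall>x. B x = (\<Union>ts \<in> A x. results M ts))"

lemma implementsI:
  assumes "wf_tm M" "tapes M = k" "alphabet M = \<Gamma>"
    and "\<And>x ts. ts \<in> A x \<Longrightarrow> halts_within M ts (poly p (length x))"
    and "\<And>x. B x = (\<Union>ts \<in> A x. results M ts)"
  shows "implements M k \<Gamma> A B"
  unfolding implements_def using assms by blast

definition runs :: "nat \<Rightarrow> sym set \<Rightarrow> family \<Rightarrow> family \<Rightarrow> bool" where
  "runs k \<Gamma> A B \<longleftrightarrow> admissible k \<Gamma> A \<and> (\<exists>M. implements M k \<Gamma> A B)"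

text \<open>A step moves each head by at most one cell and writes symbols of the alphabet, so the
  window grows by at most the running time.\<close>

lemma admissible_runs:
  assumes "runs k \<Gamma> A B"
  shows "admissible k \<Gamma> B"
proof -
  obtain M :: tm and p p' where M: "wf_tm M" "tapes M = k" "alphabet M = \<Gamma>"
    and h: "\<And>x ts. ts \<in> A x \<Longrightarrow> halts_within M ts (poly p (length x))"
    and B: "\<And>x. B x = (\<Union>ts \<in> A x. results M ts)"
    and ok: "\<And>x ts. ts \<in> A x \<Longrightarrow> tapes_ok k \<Gamma> (poly p' (length x)) ts"
  proof -
    obtain M p' where M: "implements M k \<Gamma> A B"
      and ok: "\<forall>x. \<forall>ts \<in> A x. tapes_ok k \<Gamma> (poly p' (length x)) ts"
      using assms unfolding runs_def admissible_def by blast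
    then obtain p where "\<forall>x. \<forall>ts \<in> A x. halts_within M ts (poly p (length x))"
      unfolding implements_def by blast
    with M ok that[of M p p'] show thesis by (simp add: implements_def)
  qed
  have "tapes_ok k \<Gamma> (poly (p' + p) (length x)) ts'" if ts': "ts' \<in> B x" for x ts'
  proof -
    obtain ts q n where ts: "ts \<in> A x" and n: "((start M, ts), (q, ts')) \<in> step M ^^ n"
      using ts' unfolding B results_def rtrancl_power by blast
    have "n \<le> poly p (length x)"
      using h[OF ts] n unfolding halts_within_def by blast
    moreover have "tapes_ok k \<Gamma> (poly p' (length x) + n) ts'"
      using tapes_ok_relpow[OF M(1) n] ok[OF ts] M by simp
    ultimately show ?thesis
      by (auto elim: tapes_ok_mono)
  qed
  then show ?thesis unfolding admissible_def by blast
qed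

section \<open>Renaming of states\<close>

definition shift_tm :: "nat \<Rightarrow> tm \<Rightarrow> tm" where
  "shift_tm d M = \<lparr>tapes = tapes M, states = (+) d ` states M, alphabet = alphabet M,
     start = d + start M, accepting = (+) d ` accepting M,
     trans = (\<lambda>(q, rs, q', ws). (d + q, rs, d + q', ws)) ` trans M\<rparr>"

lemma wf_shift_tm:
  assumes "wf_tm M"
  shows "wf_tm (shift_tm d M)"
proof (rule wf_tmI)
  fix q rs q' ws
  assume "(q, rs, q', ws) \<in> trans (shift_tm d M)"
  then obtain p p' where "q = d + p" "q' = d + p'" "(p, rs, p', ws) \<in> trans M"
    by (auto simp: shift_tm_def)
  with wf_transD[OF assms this(3)]
  show "q \<in> states (shift_tm d M) - accepting (shift_tm d M) \<and> q' \<in> states (shift_tm d M) \<and>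
      length rs = tapes (shift_tm d M) \<and> set rs \<subseteq> alphabet (shift_tm d M) \<and>
      length ws = tapes (shift_tm d M) \<and> fst ` set ws \<subseteq> alphabet (shift_tm d M)"
    by (simp add: shift_tm_def image_iff)
qed (use assms in \<open>auto simp: wf_tm_def shift_tm_def\<close>)

lemma step_shift_tm:
  "((q, ts), (r, ts')) \<in> step (shift_tm d M) \<longleftrightarrow>
     (\<exists>q' r'. q = d + q' \<and> r = d + r' \<and> ((q', ts), (r', ts')) \<in> step M)"
  unfolding step_def shift_tm_def by (force simp: image_iff)

lemma relpow_shift_tm:
  "((d + q, ts), c) \<in> step (shift_tm d M) ^^ n \<longleftrightarrow>
     (\<exists>r ts'. c = (d + r, ts') \<and> ((q, ts), (r, ts')) \<in> step M ^^ n)"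
proof (induction n arbitrary: c)
  case (Suc n)
  obtain r ts' where c: "c = (r, ts')" by fastforce
  show ?case
    unfolding relpow.simps relcomp_unfold c
    by (auto simp: Suc.IH step_shift_tm) blast
qed auto

lemma halts_within_shift_tm: "halts_within (shift_tm d M) ts N \<longleftrightarrow> halts_within M ts N"
proof -
  have "start (shift_tm d M) = d + start M" by (simp add: shift_tm_def)
  then show ?thesis unfolding halts_within_def by (auto simp: relpow_shift_tm)
qed

lemma results_shift_tm: "results (shift_tm d M) ts = results M ts"
proof -
  have "start (shift_tm d M) = d + start M" "accepting (shift_tm d M) = (+) d ` accepting M"
    by (simp_all add: shift_tm_def)
  then show ?thesis
    unfolding results_def by (auto simp: rtrancl_is_UN_relpow relpow_shift_tm)
qed

lemma implements_shift_tm: "implements M k \<Gamma> A B \<Longrightarrow> implements (shift_tm d M) k \<Gamma> A B"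
  unfolding implements_def
  by (simp add: wf_shift_tm halts_within_shift_tm results_shift_tm) (simp add: shift_tm_def)

text \<open>States are natural numbers, so adding a number larger than every element of
  \<open>Q\<close> moves all of them out of \<open>Q\<close>.\<close>

lemma implements_fresh_states:
  assumes "implements M k \<Gamma> A B" "finite Q"
  obtains M' where "implements M' k \<Gamma> A B" "states M' \<inter> Q = {}"
proof -
  obtain d where d: "\<forall>q \<in> Q. q < d"
    using assms(2) finite_nat_set_iff_bounded by blast
  show ?thesis
  proof
    show "implements (shift_tm d M) k \<Gamma> A B" using implements_shift_tm assms(1) .
    show "states (shift_tm d M) \<inter> Q = {}" using d by (force simp: shift_tm_def)
  qed
qed

section \<open>Sequential composition\<close>

definition seq_tm :: "tm \<Rightarrow> tm \<Rightarrow> tm" where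
  "seq_tm M1 M2 = \<lparr>tapes = tapes M1, states = states M1 \<union> states M2, alphabet = alphabet M1,
     start = start M1, accepting = accepting M2,
     trans = trans M1 \<union> jumps (accepting M1) (alphabet M1) (tapes M1) (start M2) \<union> trans M2\<rparr>"

text \<open>With disjoint states, the only passage from \<open>M1\<close> to \<open>M2\<close> is a
  jump, and there is no way back. The \<open>Suc\<close> counts the jump.\<close>

lemma relpow_seq_tm:
  assumes wf: "wf_tm M1" "wf_tm M2" and disj: "states M2 \<inter> states M1 = {}"
    and n: "((start M1, ts), c) \<in> step (seq_tm M1 M2) ^^ n"
  shows "((start M1, ts), c) \<in> step M1 ^^ n \<or>
    (\<exists>n1 n2 q ts'. ((start M1, ts), (q, ts')) \<in> step M1 ^^ n1 \<and> q \<in> accepting M1 \<and>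
       ((start M2, ts'), c) \<in> step M2 ^^ n2 \<and> n = Suc (n1 + n2))"
  using n
proof (induction n arbitrary: c)
  case (Suc n)
  then obtain d where d: "((start M1, ts), d) \<in> step (seq_tm M1 M2) ^^ n"
    "(d, c) \<in> step (seq_tm M1 M2)" by auto
  have step: "(d, c) \<in> step M1 \<or> (fst d \<in> accepting M1 \<and> c = (start M2, snd d)) \<or> (d, c) \<in> step M2"
    using d(2) by (cases d) (auto simp: step_eq_steps seq_tm_def steps_Un steps_jumps)
  from Suc.IH[OF d(1)] show ?case
  proof
    assume 1: "((start M1, ts), d) \<in> step M1 ^^ n"
    then have "fst d \<in> states M1"
      using wf_relpow_states[OF wf(1)] by blast
    then have "(d, c) \<notin> step M2" using wf_stepD[OF wf(2)] disj by blast
    with step 1 show ?thesis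
      by (metis (no_types, lifting) add.right_neutral prod.collapse relpow.simps(1) relpow_Suc_I
          pair_in_Id_conv)
  next
    assume "\<exists>n1 n2 q ts'. ((start M1, ts), (q, ts')) \<in> step M1 ^^ n1 \<and> q \<in> accepting M1 \<and>
       ((start M2, ts'), d) \<in> step M2 ^^ n2 \<and> n = Suc (n1 + n2)"
    then obtain n1 n2 q ts' where 2: "((start M1, ts), (q, ts')) \<in> step M1 ^^ n1"
      "q \<in> accepting M1" "((start M2, ts'), d) \<in> step M2 ^^ n2" "n = Suc (n1 + n2)" by blast
    then have "fst d \<in> states M2"
      using wf_relpow_states[OF wf(2)] by blast
    moreover have "accepting M1 \<subseteq> states M1" using wf(1) by (simp add: wf_tm_def)
    ultimately have "(d, c) \<in> step M2" using step wf_stepD[OF wf(1)] disj by blast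
    then have "((start M2, ts'), c) \<in> step M2 ^^ Suc n2" using 2 by auto
    moreover have "Suc n = Suc (n1 + Suc n2)" using 2 by simp
    ultimately show ?thesis using 2 by blast
  qed
qed auto

lemma wf_seq_tm:
  assumes "wf_tm M1" "wf_tm M2" "states M2 \<inter> states M1 = {}"
    "tapes M1 = tapes M2" "alphabet M1 = alphabet M2"
  shows "wf_tm (seq_tm M1 M2)"
proof (rule wf_tmI)
  fix q rs q' ws
  let ?M = "seq_tm M1 M2"
  assume "(q, rs, q', ws) \<in> trans ?M"
  then consider "(q, rs, q', ws) \<in> trans M1" | "(q, rs, q', ws) \<in> trans M2"
    | "q \<in> accepting M1" "q' = start M2" "ws = keep rs" "length rs = tapes M1" "set rs \<subseteq> alphabet M1"
    by (auto simp: seq_tm_def jumps_def)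
  then show "q \<in> states ?M - accepting ?M \<and> q' \<in> states ?M \<and> length rs = tapes ?M \<and>
      set rs \<subseteq> alphabet ?M \<and> length ws = tapes ?M \<and> fst ` set ws \<subseteq> alphabet ?M"
  proof cases
    case 1
    then show ?thesis
      using wf_transD[OF assms(1) 1] assms(2,3) by (auto simp: seq_tm_def wf_tm_def)
  next
    case 2
    then show ?thesis
      using wf_transD[OF assms(2) 2] assms(4,5) by (auto simp: seq_tm_def)
  next
    case 3
    moreover have "accepting M1 \<subseteq> states M1" "accepting M2 \<subseteq> states M2" "start M2 \<in> states M2"
      using assms(1,2) by (auto simp: wf_tm_def)
    ultimately show ?thesis using assms(3) by (auto simp: seq_tm_def)
  qed
qed (use assms in \<open>auto simp: wf_tm_def seq_tm_def\<close>)

lemma runs_seq: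
  assumes "runs k \<Gamma> A B" "runs k \<Gamma> B C"
  shows "runs k \<Gamma> A C"
proof -
  obtain M1 where M1: "implements M1 k \<Gamma> A B" and ok: "admissible k \<Gamma> A"
    using assms(1) unfolding runs_def by blast
  obtain M where "implements M k \<Gamma> B C"
    using assms(2) unfolding runs_def by blast
  moreover have "finite (states M1)" using M1 by (simp add: implements_def wf_tm_def)
  ultimately obtain M2 where M2: "implements M2 k \<Gamma> B C" and disj: "states M2 \<inter> states M1 = {}"
    using implements_fresh_states by blast
  have wf: "wf_tm M1" "wf_tm M2" "tapes M1 = k" "tapes M2 = k" "alphabet M1 = \<Gamma>" "alphabet M2 = \<Gamma>"
    using M1 M2 by (auto simp: implements_def)
  obtain p1 where h1: "\<And>x ts. ts \<in> A x \<Longrightarrow> halts_within M1 ts (poly p1 (length x))"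
    using M1 unfolding implements_def by blast
  obtain p2 where h2: "\<And>x ts. ts \<in> B x \<Longrightarrow> halts_within M2 ts (poly p2 (length x))"
    using M2 unfolding implements_def by blast
  have B: "\<And>x. B x = (\<Union>ts \<in> A x. results M1 ts)" and C: "\<And>x. C x = (\<Union>ts \<in> B x. results M2 ts)"
    using M1 M2 by (auto simp: implements_def)
  let ?M = "seq_tm M1 M2"
  have se: "start ?M = start M1" "accepting ?M = accepting M2" by (simp_all add: seq_tm_def)
  note path = relpow_seq_tm[OF wf(1,2) disj]
  have acc1: "accepting M1 \<subseteq> states M1" and acc2: "accepting M2 \<subseteq> states M2"
    using wf by (auto simp: wf_tm_def)
  have in_B: "ts' \<in> B x"
    if "ts \<in> A x" "((start M1, ts), (q, ts')) \<in> step M1 ^^ n" "q \<in> accepting M1" for x ts q ts' n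
    using that relpow_imp_rtrancl unfolding B results_def by fastforce
  have "halts_within ?M ts (poly (p1 + 1 + p2) (length x))" if ts: "ts \<in> A x" for x ts
    unfolding halts_within_def
  proof (intro allI impI)
    fix n c
    assume "((start ?M, ts), c) \<in> step ?M ^^ n"
    then have "((start M1, ts), c) \<in> step ?M ^^ n" by (simp add: seq_tm_def)
    from path[OF this] show "n \<le> poly (p1 + 1 + p2) (length x)"
    proof
      assume "((start M1, ts), c) \<in> step M1 ^^ n"
      then show ?thesis using h1[OF ts] unfolding halts_within_def by fastforce
    next
      assume "\<exists>n1 n2 q ts'. ((start M1, ts), (q, ts')) \<in> step M1 ^^ n1 \<and> q \<in> accepting M1 \<and>
         ((start M2, ts'), c) \<in> step M2 ^^ n2 \<and> n = Suc (n1 + n2)"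
      then obtain n1 n2 q ts' where 2: "((start M1, ts), (q, ts')) \<in> step M1 ^^ n1"
        "q \<in> accepting M1" "((start M2, ts'), c) \<in> step M2 ^^ n2" "n = Suc (n1 + n2)" by blast
      then have "n1 \<le> poly p1 (length x)" "n2 \<le> poly p2 (length x)"
        using h1[OF ts] h2[OF in_B[OF ts 2(1,2)]] unfolding halts_within_def by blast+
      then show ?thesis using 2 by simp
    qed
  qed
  moreover have "C x = (\<Union>ts \<in> A x. results ?M ts)" for x
  proof (intro equalityI subsetI)
    fix ts2
    assume "ts2 \<in> C x"
    then obtain ts ts1 q1 q2 where ts: "ts \<in> A x" and "q1 \<in> accepting M1" "q2 \<in> accepting M2"
      and r1: "((start M1, ts), (q1, ts1)) \<in> (step M1)\<^sup>*"
      and r2: "((start M2, ts1), (q2, ts2)) \<in> (step M2)\<^sup>*"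
      unfolding C B results_def by blast
    have sub: "step M1 \<subseteq> step ?M" "step M2 \<subseteq> step ?M"
      by (auto simp: step_eq_steps seq_tm_def steps_Un)
    \<comment> \<open>The jump exists only for symbols of \<open>\<Gamma>\<close>; the tapes on
      which \<open>M1\<close> accepts carry no others.\<close>
    obtain n where "tapes_ok k \<Gamma> n ts" using ok ts unfolding admissible_def by blast
    then obtain m where "tapes_ok k \<Gamma> m ts1"
      using tapes_ok_rtrancl[OF wf(1) r1] wf by auto
    then have "((q1, ts1), (start M2, ts1)) \<in> step ?M"
      using \<open>q1 \<in> accepting M1\<close> tapes_ok_scan tapes_ok_length wf
      by (auto simp: step_eq_steps seq_tm_def steps_Un steps_jumps)
    then have "((start M1, ts), (q2, ts2)) \<in> (step ?M)\<^sup>*"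
      using r1 r2 sub by (meson in_mono rtrancl_mono rtrancl_trans rtrancl.rtrancl_into_rtrancl)
    then have "ts2 \<in> results ?M ts"
      using \<open>q2 \<in> accepting M2\<close> unfolding results_def by (auto simp: seq_tm_def)
    then show "ts2 \<in> (\<Union>ts \<in> A x. results ?M ts)" using ts by blast
  next
    fix ts2
    assume "ts2 \<in> (\<Union>ts \<in> A x. results ?M ts)"
    then obtain ts q2 n where ts: "ts \<in> A x" and q2: "q2 \<in> accepting M2"
      and n: "((start M1, ts), (q2, ts2)) \<in> step ?M ^^ n"
      unfolding results_def rtrancl_power se by blast
    \<comment> \<open>A path still inside \<open>M1\<close> cannot end in an accepting state of
      \<open>M2\<close>, so the second alternative of \<open>path\<close> applies.\<close>
    have "((start M1, ts), (q2, ts2)) \<notin> step M1 ^^ n"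
    proof
      assume "((start M1, ts), (q2, ts2)) \<in> step M1 ^^ n"
      then have "q2 \<in> states M1"
        using wf_relpow_states[OF wf(1)] by fastforce
      then show False using q2 acc2 disj by blast
    qed
    with path[OF n] show "ts2 \<in> C x"
      using in_B[OF ts] q2 unfolding C results_def by (blast dest: relpow_imp_rtrancl)
  qed
  moreover have "wf_tm ?M" using wf_seq_tm[OF wf(1,2) disj] wf by simp
  moreover have "tapes ?M = k" "alphabet ?M = \<Gamma>" using wf by (simp_all add: seq_tm_def)
  ultimately have "implements ?M k \<Gamma> A C" by (intro implementsI)
  then show ?thesis using ok unfolding runs_def by blast
qed

section \<open>Nondeterministic choice\<close>

definition choice_tm :: "tm \<Rightarrow> tm \<Rightarrow> tm" where
  "choice_tm M1 M2 = \<lparr>tapes = tapes M1, states = insert 0 (states M1 \<union> states M2),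
     alphabet = alphabet M1, start = 0, accepting = accepting M1 \<union> accepting M2,
     trans = jumps {0} (alphabet M1) (tapes M1) (start M1) \<union>
       jumps {0} (alphabet M1) (tapes M1) (start M2) \<union> (trans M1 \<union> trans M2)\<rparr>"

lemma relpow_choice_tm:
  assumes wf: "wf_tm M1" "wf_tm M2" and disj: "states M1 \<inter> {0} = {}" "states M2 \<inter> insert 0 (states M1) = {}"
    and n: "((0, ts), c) \<in> step (choice_tm M1 M2) ^^ n"
  shows "n = 0 \<and> c = (0, ts) \<or>
    (\<exists>m. n = Suc m \<and> (((start M1, ts), c) \<in> step M1 ^^ m \<or> ((start M2, ts), c) \<in> step M2 ^^ m))"
  using n
proof (induction n arbitrary: c)
  case (Suc n)
  then obtain d where d: "((0, ts), d) \<in> step (choice_tm M1 M2) ^^ n"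
    "(d, c) \<in> step (choice_tm M1 M2)" by auto
  have step: "(d, c) \<in> step M1 \<or> (d, c) \<in> step M2 \<or>
      fst d = 0 \<and> (c = (start M1, snd d) \<or> c = (start M2, snd d))"
    using d(2) by (cases d) (auto simp: step_eq_steps choice_tm_def steps_Un steps_jumps)
  from Suc.IH[OF d(1)] consider "n = 0" "d = (0, ts)"
    | m where "n = Suc m" "((start M1, ts), d) \<in> step M1 ^^ m"
    | m where "n = Suc m" "((start M2, ts), d) \<in> step M2 ^^ m" by blast
  then show ?case
  proof cases
    case 1
    then have "fst d \<notin> states M1" "fst d \<notin> states M2" using disj by auto
    then have "(d, c) \<notin> step M1" "(d, c) \<notin> step M2"
      using wf_stepD(1)[OF wf(1)] wf_stepD(1)[OF wf(2)] by blast+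
    with step 1 show ?thesis by auto
  next
    case (2 m)
    then have "fst d \<in> states M1" using wf_relpow_states[OF wf(1)] by blast
    moreover from this have "(d, c) \<notin> step M2" using disj wf_stepD(1)[OF wf(2)] by blast
    ultimately have "(d, c) \<in> step M1" using step disj by auto
    with 2 show ?thesis by auto
  next
    case (3 m)
    then have "fst d \<in> states M2" using wf_relpow_states[OF wf(2)] by blast
    moreover from this have "(d, c) \<notin> step M1" using disj wf_stepD(1)[OF wf(1)] by blast
    ultimately have "(d, c) \<in> step M2" using step disj by auto
    with 3 show ?thesis by auto
  qed
qed auto

lemma wf_choice_tm:
  assumes "wf_tm M1" "wf_tm M2" "states M1 \<inter> {0} = {}" "states M2 \<inter> insert 0 (states M1) = {}"
    "tapes M1 = tapes M2" "alphabet M1 = alphabet M2"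
  shows "wf_tm (choice_tm M1 M2)"
proof (rule wf_tmI)
  fix q rs q' ws
  let ?M = "choice_tm M1 M2"
  have acc: "accepting M1 \<subseteq> states M1" "accepting M2 \<subseteq> states M2"
    "start M1 \<in> states M1" "start M2 \<in> states M2"
    using assms(1,2) by (auto simp: wf_tm_def)
  assume "(q, rs, q', ws) \<in> trans ?M"
  then consider "(q, rs, q', ws) \<in> trans M1" | "(q, rs, q', ws) \<in> trans M2"
    | "q = 0" "q' \<in> {start M1, start M2}" "ws = keep rs" "length rs = tapes M1" "set rs \<subseteq> alphabet M1"
    by (auto simp: choice_tm_def jumps_def)
  then show "q \<in> states ?M - accepting ?M \<and> q' \<in> states ?M \<and> length rs = tapes ?M \<and>
      set rs \<subseteq> alphabet ?M \<and> length ws = tapes ?M \<and> fst ` set ws \<subseteq> alphabet ?M"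
  proof cases
    case 1
    then show ?thesis
      using wf_transD[OF assms(1) 1] assms(3,4) acc by (auto simp: choice_tm_def)
  next
    case 2
    then show ?thesis
      using wf_transD[OF assms(2) 2] assms(3-6) acc by (auto simp: choice_tm_def)
  next
    case 3
    then show ?thesis using assms(3,4) acc by (auto simp: choice_tm_def)
  qed
qed (use assms in \<open>auto simp: wf_tm_def choice_tm_def\<close>)

text \<open>This is what allows programs to guess: as rejection is the empty set, a branch whose
  guess turns out wrong contributes nothing to the union.\<close>

lemma runs_Un:
  assumes "runs k \<Gamma> A B" "runs k \<Gamma> A C"
  shows "runs k \<Gamma> A (\<lambda>x. B x \<union> C x)"
proof -
  obtain M where "implements M k \<Gamma> A B" and ok: "admissible k \<Gamma> A"
    using assms(1) unfolding runs_def by blast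
  then obtain M1 where M1: "implements M1 k \<Gamma> A B" and disj1: "states M1 \<inter> {0} = {}"
    using implements_fresh_states[of M k \<Gamma> A B "{0}"] by blast
  obtain M' where "implements M' k \<Gamma> A C"
    using assms(2) unfolding runs_def by blast
  moreover have "finite (insert 0 (states M1))" using M1 by (simp add: implements_def wf_tm_def)
  ultimately obtain M2 where M2: "implements M2 k \<Gamma> A C" and disj2: "states M2 \<inter> insert 0 (states M1) = {}"
    using implements_fresh_states by blast
  have wf: "wf_tm M1" "wf_tm M2" "tapes M1 = k" "tapes M2 = k" "alphabet M1 = \<Gamma>" "alphabet M2 = \<Gamma>"
    using M1 M2 by (auto simp: implements_def)
  obtain p1 where h1: "\<And>x ts. ts \<in> A x \<Longrightarrow> halts_within M1 ts (poly p1 (length x))"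
    using M1 unfolding implements_def by blast
  obtain p2 where h2: "\<And>x ts. ts \<in> A x \<Longrightarrow> halts_within M2 ts (poly p2 (length x))"
    using M2 unfolding implements_def by blast
  have B: "\<And>x. B x = (\<Union>ts \<in> A x. results M1 ts)" and C: "\<And>x. C x = (\<Union>ts \<in> A x. results M2 ts)"
    using M1 M2 by (auto simp: implements_def)
  let ?M = "choice_tm M1 M2"
  have st: "start ?M = 0" and acc: "accepting ?M = accepting M1 \<union> accepting M2"
    by (simp_all add: choice_tm_def)
  have sub: "accepting M1 \<subseteq> states M1" "accepting M2 \<subseteq> states M2"
    using wf by (auto simp: wf_tm_def)
  note path = relpow_choice_tm[OF wf(1,2) disj1 disj2]
  have "halts_within ?M ts (poly (1 + p1 + p2) (length x))" if ts: "ts \<in> A x" for x ts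
    unfolding halts_within_def st
  proof (intro allI impI)
    fix n c
    assume "((0, ts), c) \<in> step ?M ^^ n"
    from path[OF this] show "n \<le> poly (1 + p1 + p2) (length x)"
      using h1[OF ts] h2[OF ts] unfolding halts_within_def by fastforce
  qed
  moreover have "results ?M ts = results M1 ts \<union> results M2 ts" if ts: "ts \<in> A x" for x ts
  proof (intro equalityI subsetI)
    fix ts'
    assume "ts' \<in> results ?M ts"
    then obtain q n where q: "q \<in> accepting M1 \<union> accepting M2"
      and n: "((0, ts), (q, ts')) \<in> step ?M ^^ n"
      unfolding results_def st acc rtrancl_power by blast
    have q0: "q \<noteq> 0" using q sub disj1 disj2 by auto
    then obtain m where "((start M1, ts), (q, ts')) \<in> step M1 ^^ m \<or> ((start M2, ts), (q, ts')) \<in> step M2 ^^ m"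
      using path[OF n] by auto
    then show "ts' \<in> results M1 ts \<union> results M2 ts"
    proof
      assume m: "((start M1, ts), (q, ts')) \<in> step M1 ^^ m"
      then have "q \<in> states M1" using wf_relpow_states[OF wf(1)] by fastforce
      then have "q \<in> accepting M1" using q sub disj2 by auto
      then show ?thesis using m unfolding results_def rtrancl_power by blast
    next
      assume m: "((start M2, ts), (q, ts')) \<in> step M2 ^^ m"
      then have "q \<in> states M2" using wf_relpow_states[OF wf(2)] by fastforce
      then have "q \<in> accepting M2" using q sub disj2 by auto
      then show ?thesis using m unfolding results_def rtrancl_power by blast
    qed
  next
    obtain n where "tapes_ok k \<Gamma> n ts" using ok ts unfolding admissible_def by blast
    then have jump: "((0, ts), (start M1, ts)) \<in> step ?M" "((0, ts), (start M2, ts)) \<in> step ?M"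
      using tapes_ok_scan[of k \<Gamma> n ts] tapes_ok_length[of k \<Gamma> n ts] wf
      by (simp_all add: step_eq_steps choice_tm_def steps_Un steps_jumps)
    have mono: "(step M1)\<^sup>* \<subseteq> (step ?M)\<^sup>*" "(step M2)\<^sup>* \<subseteq> (step ?M)\<^sup>*"
      by (intro rtrancl_mono; auto simp: step_eq_steps choice_tm_def steps_Un)+
    fix ts'
    assume "ts' \<in> results M1 ts \<union> results M2 ts"
    then obtain q where "q \<in> accepting ?M" "((start M1, ts), (q, ts')) \<in> (step ?M)\<^sup>* \<or> ((start M2, ts), (q, ts')) \<in> (step ?M)\<^sup>*"
      using mono unfolding results_def acc by blast
    then show "ts' \<in> results ?M ts"
      using jump unfolding results_def st by (blast intro: converse_rtrancl_into_rtrancl)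
  qed
  then have "\<And>x. B x \<union> C x = (\<Union>ts \<in> A x. results ?M ts)" unfolding B C by blast
  moreover have "wf_tm ?M" using wf_choice_tm[OF wf(1,2) disj1 disj2] wf by simp
  moreover have "tapes ?M = k" "alphabet ?M = \<Gamma>" using wf by (simp_all add: choice_tm_def)
  ultimately have "implements ?M k \<Gamma> A (\<lambda>x. B x \<union> C x)" by (intro implementsI)
  then show ?thesis using ok unfolding runs_def by blast
qed

section \<open>Running a machine on a block of tapes\<close>

definition lift_tm :: "nat \<Rightarrow> nat \<Rightarrow> sym set \<Rightarrow> tm \<Rightarrow> tm" where
  "lift_tm a b \<Gamma> M = \<lparr>tapes = a + tapes M + b, states = states M, alphabet = \<Gamma>,
     start = start M, accepting = accepting M,
     trans = {(q, us @ rs @ vs, q', keep us @ ws @ keep vs) | q us rs vs q' ws.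
       (q, rs, q', ws) \<in> trans M \<and> length us = a \<and> length vs = b \<and> set us \<subseteq> \<Gamma> \<and> set vs \<subseteq> \<Gamma>}\<rparr>"

lemma wf_lift_tm:
  assumes "wf_tm M" "alphabet M \<subseteq> \<Gamma>" "finite \<Gamma>"
  shows "wf_tm (lift_tm a b \<Gamma> M)"
proof (rule wf_tmI)
  fix q rs q' ws
  let ?M = "lift_tm a b \<Gamma> M"
  assume "(q, rs, q', ws) \<in> trans ?M"
  then obtain us rs' vs ws' where *: "rs = us @ rs' @ vs" "ws = keep us @ ws' @ keep vs"
    "(q, rs', q', ws') \<in> trans M" "length us = a" "length vs = b" "set us \<subseteq> \<Gamma>" "set vs \<subseteq> \<Gamma>"
    by (auto simp: lift_tm_def)
  show "q \<in> states ?M - accepting ?M \<and> q' \<in> states ?M \<and> length rs = tapes ?M \<and>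
      set rs \<subseteq> alphabet ?M \<and> length ws = tapes ?M \<and> fst ` set ws \<subseteq> alphabet ?M"
    using wf_transD[OF assms(1) *(3)] * assms(2)
    by (simp add: lift_tm_def image_Un) blast
qed (use assms in \<open>auto simp: wf_tm_def lift_tm_def\<close>)

lemma step_lift_tm:
  assumes "wf_tm M" and len: "length pre = a" "length ts = tapes M" "length post = b"
    and "scan ` set pre \<subseteq> \<Gamma>" "scan ` set post \<subseteq> \<Gamma>"
  shows "((q, pre @ ts @ post), c) \<in> step (lift_tm a b \<Gamma> M) \<longleftrightarrow>
    (\<exists>q' ts'. c = (q', pre @ ts' @ post) \<and> ((q, ts), (q', ts')) \<in> step M)"
proof -
  have act: "map2 act (keep (map scan pre) @ ws @ keep (map scan post)) (pre @ ts @ post) =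
      pre @ map2 act ws ts @ post" if "length ws = tapes M" for ws
    using that len by simp
  show ?thesis
  proof
    assume "((q, pre @ ts @ post), c) \<in> step (lift_tm a b \<Gamma> M)"
    then obtain us rs vs q' ws where *: "map scan (pre @ ts @ post) = us @ rs @ vs"
      "(q, rs, q', ws) \<in> trans M" "length us = a" "length vs = b"
      "c = (q', map2 act (keep us @ ws @ keep vs) (pre @ ts @ post))"
      unfolding step_eq_steps steps_iff by (auto simp: lift_tm_def)
    have l: "length rs = tapes M" "length ws = tapes M" using wf_transD[OF assms(1) *(2)] by auto
    have "us = map scan pre" "rs = map scan ts" "vs = map scan post"
      using *(1,3,4) len l by auto
    with * l act show "\<exists>q' ts'. c = (q', pre @ ts' @ post) \<and> ((q, ts), (q', ts')) \<in> step M"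
      unfolding step_eq_steps steps_iff by auto
  next
    assume "\<exists>q' ts'. c = (q', pre @ ts' @ post) \<and> ((q, ts), (q', ts')) \<in> step M"
    then obtain q' ws where *: "c = (q', pre @ map2 act ws ts @ post)"
      "(q, map scan ts, q', ws) \<in> trans M"
      unfolding step_eq_steps steps_iff by auto
    have "(q, map scan (pre @ ts @ post), q', keep (map scan pre) @ ws @ keep (map scan post))
        \<in> trans (lift_tm a b \<Gamma> M)"
    proof -
      have "map scan (pre @ ts @ post) = map scan pre @ map scan ts @ map scan post" by simp
      moreover have "length (map scan pre) = a" "length (map scan post) = b"
        "set (map scan pre) \<subseteq> \<Gamma>" "set (map scan post) \<subseteq> \<Gamma>"
        using assms by simp_all
      ultimately show ?thesis using *(2) unfolding lift_tm_def tm.select_convs by blast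
    qed
    then show "((q, pre @ ts @ post), c) \<in> step (lift_tm a b \<Gamma> M)"
      unfolding step_eq_steps steps_iff *(1) using act wf_transD(6)[OF assms(1) *(2)] by metis
  qed
qed

lemma step_length:
  assumes "wf_tm M" "((q, ts), (q', ts')) \<in> step M"
  shows "length ts = tapes M" "length ts' = tapes M"
proof -
  obtain ws where "(q, map scan ts, q', ws) \<in> trans M" "ts' = map2 act ws ts"
    using assms(2) unfolding step_eq_steps steps_iff by auto
  then show "length ts = tapes M" "length ts' = tapes M"
    using wf_transD[OF assms(1)] by fastforce+
qed

lemma relpow_length:
  assumes "wf_tm M" "((q, ts), (q', ts')) \<in> step M ^^ n" "length ts = tapes M"
  shows "length ts' = tapes M"
  using assms(2,3) step_length(2)[OF assms(1)] by (cases n) auto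

lemma relpow_lift_tm:
  assumes "wf_tm M" and len: "length pre = a" "length ts = tapes M" "length post = b"
    and "scan ` set pre \<subseteq> \<Gamma>" "scan ` set post \<subseteq> \<Gamma>"
  shows "((q, pre @ ts @ post), c) \<in> step (lift_tm a b \<Gamma> M) ^^ n \<longleftrightarrow>
    (\<exists>q' ts'. c = (q', pre @ ts' @ post) \<and> ((q, ts), (q', ts')) \<in> step M ^^ n)"
proof (induction n arbitrary: c)
  case (Suc n)
  have "((q, pre @ ts @ post), c) \<in> step (lift_tm a b \<Gamma> M) ^^ Suc n \<longleftrightarrow>
      (\<exists>q' ts'. ((q, ts), (q', ts')) \<in> step M ^^ n \<and>
        ((q', pre @ ts' @ post), c) \<in> step (lift_tm a b \<Gamma> M))"
    using Suc.IH by (auto simp: relcomp_unfold)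
  also have "\<dots> \<longleftrightarrow> (\<exists>q' ts'. ((q, ts), (q', ts')) \<in> step M ^^ n \<and>
        (\<exists>r us. c = (r, pre @ us @ post) \<and> ((q', ts'), (r, us)) \<in> step M))"
    using step_lift_tm[OF assms(1) len(1) _ len(3) assms(5,6)] relpow_length[OF assms(1) _ len(2)]
    by (metis (no_types, lifting))
  also have "\<dots> \<longleftrightarrow> (\<exists>q' ts'. c = (q', pre @ ts' @ post) \<and> ((q, ts), (q', ts')) \<in> step M ^^ Suc n)"
    by (auto simp: relcomp_unfold)
  finally show ?case .
qed auto

text \<open>\<open>D\<close> consists of triples and is not a product: the tapes around the block
  may depend on those inside it, and each result has to be put back between its own neighbours. The
  time bound is a hypothesis because the block may hold an input other than
  \<open>x\<close>.\<close>

lemma runs_lift: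
  fixes M :: tm
  assumes wf: "wf_tm M" "alphabet M \<subseteq> \<Gamma>" "finite \<Gamma>"
    and adm: "admissible (a + tapes M + b) \<Gamma> (\<lambda>x. {pre @ ts @ post | pre ts post. (pre, ts, post) \<in> D x})"
    and len: "\<And>x pre ts post. (pre, ts, post) \<in> D x \<Longrightarrow>
      length pre = a \<and> length ts = tapes M \<and> length post = b"
    and time: "\<And>x pre ts post. (pre, ts, post) \<in> D x \<Longrightarrow> halts_within M ts (poly p (length x))"
  shows "runs (a + tapes M + b) \<Gamma> (\<lambda>x. {pre @ ts @ post | pre ts post. (pre, ts, post) \<in> D x})
    (\<lambda>x. {pre @ ts' @ post | pre ts ts' post. (pre, ts, post) \<in> D x \<and> ts' \<in> results M ts})"
    (is "runs _ _ ?A ?B")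
proof -
  let ?M = "lift_tm a b \<Gamma> M"
  have st: "start ?M = start M" "accepting ?M = accepting M" by (simp_all add: lift_tm_def)
  have path: "((q, pre @ ts @ post), c) \<in> step ?M ^^ n \<longleftrightarrow>
      (\<exists>q' ts'. c = (q', pre @ ts' @ post) \<and> ((q, ts), (q', ts')) \<in> step M ^^ n)"
    if D: "(pre, ts, post) \<in> D x" for x pre ts post q c n
  proof -
    obtain m where "tapes_ok (a + tapes M + b) \<Gamma> m (pre @ ts @ post)"
      using adm D unfolding admissible_def by blast
    from tapes_ok_scan[OF this] have "scan ` set pre \<subseteq> \<Gamma>" "scan ` set post \<subseteq> \<Gamma>"
      unfolding set_append by blast+
    then show ?thesis
      using len[OF D] by (intro relpow_lift_tm[OF wf(1)]) simp_all
  qed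
  have "halts_within ?M ts (poly p (length x))" if A: "ts \<in> ?A x" for x ts
  proof -
    obtain pre us post where D: "(pre, us, post) \<in> D x" and ts: "ts = pre @ us @ post"
      using A by blast
    show ?thesis
      unfolding halts_within_def st ts path[OF D]
      using time[OF D] unfolding halts_within_def by blast
  qed
  moreover have "?B x = (\<Union>ts \<in> ?A x. results ?M ts)" for x
  proof -
    have res: "results ?M (pre @ ts @ post) = {pre @ ts' @ post | ts'. ts' \<in> results M ts}"
      if D: "(pre, ts, post) \<in> D x" for pre ts post
      unfolding results_def st rtrancl_power path[OF D] by blast
    show ?thesis
    proof (intro equalityI subsetI)
      fix us
      assume "us \<in> ?B x"
      then obtain pre ts ts' post where D: "(pre, ts, post) \<in> D x"
        and us: "us = pre @ ts' @ post" "ts' \<in> results M ts" by blast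
      have "us \<in> results ?M (pre @ ts @ post)" unfolding res[OF D] using us by blast
      then show "us \<in> (\<Union>ts \<in> ?A x. results ?M ts)" using D by blast
    next
      fix us
      assume "us \<in> (\<Union>ts \<in> ?A x. results ?M ts)"
      then obtain pre ts post where D: "(pre, ts, post) \<in> D x"
        and "us \<in> results ?M (pre @ ts @ post)" by blast
      then show "us \<in> ?B x" unfolding res[OF D] by blast
    qed
  qed
  moreover have "wf_tm ?M" using wf_lift_tm[OF wf] .
  moreover have "tapes ?M = a + tapes M + b" "alphabet ?M = \<Gamma>" by (simp_all add: lift_tm_def)
  ultimately have "implements ?M (a + tapes M + b) \<Gamma> ?A ?B" by (intro implementsI)
  then show ?thesis using adm unfolding runs_def by blast
qed


section \<open>Loops with one working state\<close>

text \<open>The flag returned by \<open>\<delta>\<close> tells whether to repeat or to leave; the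
  action that comes with leaving is performed as well. Where \<open>\<delta>\<close> is undefined
  the machine is stuck outside its accepting state and thus rejects.\<close>

definition loop_tm ::
    "nat \<Rightarrow> sym set \<Rightarrow> (sym list \<Rightarrow> (bool \<times> (sym \<times> dir) list) option) \<Rightarrow> tm" where
  "loop_tm k \<Gamma> \<delta> = \<lparr>tapes = k, states = {0, 1}, alphabet = \<Gamma>, start = 0, accepting = {1},
     trans = {(0, rs, if b then 0 else 1, ws) | rs b ws.
       length rs = k \<and> set rs \<subseteq> \<Gamma> \<and> \<delta> rs = Some (b, ws)}\<rparr>"

lemma step_loop_tm:
  "((q, ts), c) \<in> step (loop_tm k \<Gamma> \<delta>) \<longleftrightarrow> q = 0 \<and> length ts = k \<and> scan ` set ts \<subseteq> \<Gamma> \<and>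
     (\<exists>b ws. \<delta> (map scan ts) = Some (b, ws) \<and> c = (if b then 0 else 1, map2 act ws ts))"
  unfolding step_eq_steps steps_iff by (auto simp: loop_tm_def)

lemma wf_loop_tm:
  assumes "1 \<le> k" "finite \<Gamma>" "{Blank, Bit False, Bit True} \<subseteq> \<Gamma>"
    and \<delta>: "\<And>rs b ws. \<delta> rs = Some (b, ws) \<Longrightarrow> length rs = k \<Longrightarrow> set rs \<subseteq> \<Gamma> \<Longrightarrow>
      length ws = k \<and> fst ` set ws \<subseteq> \<Gamma>"
  shows "wf_tm (loop_tm k \<Gamma> \<delta>)"
proof (rule wf_tmI)
  fix q rs q' ws
  let ?M = "loop_tm k \<Gamma> \<delta>"
  assume "(q, rs, q', ws) \<in> trans ?M"
  then obtain b where "q = 0" "q' \<in> {0, 1}" "\<delta> rs = Some (b, ws)" "length rs = k" "set rs \<subseteq> \<Gamma>"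
    by (auto simp: loop_tm_def)
  with \<delta>[of rs b ws] show "q \<in> states ?M - accepting ?M \<and> q' \<in> states ?M \<and> length rs = tapes ?M \<and>
      set rs \<subseteq> alphabet ?M \<and> length ws = tapes ?M \<and> fst ` set ws \<subseteq> alphabet ?M"
    by (simp add: loop_tm_def)
qed (use assms in \<open>auto simp: loop_tm_def\<close>)

text \<open>
  In this rule \<open>tss\<close> is the sequence of tape lists passed by the loop, which leaves (or gets
  stuck) after \<open>n\<close> rounds; \<open>None\<close> marks rejection.
\<close>

lemma runs_loop:
  assumes adm: "admissible k \<Gamma> A" and k: "1 \<le> k" "finite \<Gamma>" "{Blank, Bit False, Bit True} \<subseteq> \<Gamma>"
    and \<delta>: "\<And>rs b ws. \<delta> rs = Some (b, ws) \<Longrightarrow> length rs = k \<Longrightarrow> set rs \<subseteq> \<Gamma> \<Longrightarrow>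
      length ws = k \<and> fst ` set ws \<subseteq> \<Gamma>"
    and rounds: "\<And>x ts. ts \<in> A x \<Longrightarrow> \<exists>n \<le> poly p (length x). \<exists>tss. tss 0 = ts \<and>
      (\<forall>m<n. \<exists>ws. \<delta> (map scan (tss m)) = Some (True, ws) \<and> tss (Suc m) = map2 act ws (tss m)) \<and>
      (case \<delta> (map scan (tss n)) of None \<Rightarrow> F ts = None
        | Some (b, ws) \<Rightarrow> \<not> b \<and> F ts = Some (map2 act ws (tss n)))"
  shows "runs k \<Gamma> A (\<lambda>x. {ts'. \<exists>ts \<in> A x. F ts = Some ts'})"
proof -
  let ?M = "loop_tm k \<Gamma> \<delta>"
  have wf: "wf_tm ?M" using wf_loop_tm[OF k, of \<delta>] \<delta> by blast
  have M: "start ?M = 0" "accepting ?M = {1}" "tapes ?M = k" "alphabet ?M = \<Gamma>"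
    by (simp_all add: loop_tm_def)
  \<comment> \<open>The extra step is the one that leaves the loop.\<close>
  have "halts_within ?M ts (poly (p + 1) (length x)) \<and> results ?M ts = {ts'. F ts = Some ts'}"
    if A: "ts \<in> A x" for x ts
  proof -
    obtain n tss where n: "n \<le> poly p (length x)" and tss0: "tss 0 = ts"
      and tss: "\<And>m. m < n \<Longrightarrow>
        \<exists>ws. \<delta> (map scan (tss m)) = Some (True, ws) \<and> tss (Suc m) = map2 act ws (tss m)"
      and end': "case \<delta> (map scan (tss n)) of None \<Rightarrow> F ts = None
        | Some (b, ws) \<Rightarrow> \<not> b \<and> F ts = Some (map2 act ws (tss n))"
      using rounds[OF A] by blast
    obtain l where ok: "tapes_ok k \<Gamma> l ts" using adm A unfolding admissible_def by blast
    have reach: "((0, ts), (0, tss m)) \<in> step ?M ^^ m \<and> length (tss m) = k \<and> scan ` set (tss m) \<subseteq> \<Gamma>"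
      if "m \<le> n" for m
      using that
    proof (induction m)
      case 0
      then show ?case using tapes_ok_scan[OF ok] tapes_ok_length[OF ok] tss0 by simp
    next
      case (Suc m)
      then have IH: "((0, ts), (0, tss m)) \<in> step ?M ^^ m" "length (tss m) = k" "scan ` set (tss m) \<subseteq> \<Gamma>"
        by simp_all
      have "((0, tss m), (0, tss (Suc m))) \<in> step ?M"
        using tss[of m] Suc.prems IH unfolding step_loop_tm by auto
      then have *: "((0, ts), (0, tss (Suc m))) \<in> step ?M ^^ Suc m"
        using IH(1) by auto
      have "tapes_ok k \<Gamma> (l + Suc m) (tss (Suc m))"
        using tapes_ok_relpow[OF wf *, of l] ok unfolding M by simp
      from tapes_ok_scan[OF this] tapes_ok_length[OF this] * show ?case by blast
    qed
    have path: "m \<le> n \<and> c = (0, tss m) \<or>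
        m = Suc n \<and> (\<exists>ts'. c = (1, ts') \<and> F ts = Some ts')"
      if "((0, ts), c) \<in> step ?M ^^ m" for m c
      using that
    proof (induction m arbitrary: c)
      case 0
      then show ?case using tss0 by simp
    next
      case (Suc m)
      then obtain d where d: "((0, ts), d) \<in> step ?M ^^ m" "(d, c) \<in> step ?M" by auto
      have "fst d = 0" using d(2) by (cases d) (simp add: step_loop_tm)
      then have m: "m \<le> n" "d = (0, tss m)" using Suc.IH[OF d(1)] by auto
      obtain b ws where b: "\<delta> (map scan (tss m)) = Some (b, ws)"
        "c = (if b then 0 else 1, map2 act ws (tss m))"
        using d(2) unfolding m step_loop_tm by blast
      show ?case
      proof (cases "m = n")
        case True
        then show ?thesis using end' b by simp
      next
        case False
        then have "m < n" using m by simp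
        then show ?thesis using tss[of m] b by auto
      qed
    qed
    have "halts_within ?M ts (poly (p + 1) (length x))"
      unfolding halts_within_def M using path n by fastforce
    moreover have "ts' \<in> results ?M ts \<longleftrightarrow> F ts = Some ts'" for ts'
    proof
      assume "ts' \<in> results ?M ts"
      then obtain m where "((0, ts), (1, ts')) \<in> step ?M ^^ m"
        unfolding results_def M rtrancl_power by blast
      from path[OF this] show "F ts = Some ts'" by simp
    next
      assume F: "F ts = Some ts'"
      then obtain ws where "\<delta> (map scan (tss n)) = Some (False, ws)" "ts' = map2 act ws (tss n)"
        using end' by (auto split: option.splits)
      then have "((0, tss n), (1, ts')) \<in> step ?M"
        using reach[of n] unfolding step_loop_tm by auto
      then have "((0, ts), (1, ts')) \<in> (step ?M)\<^sup>*"
        using reach[of n] relpow_imp_rtrancl rtrancl.rtrancl_into_rtrancl le_refl by metis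
      then show "ts' \<in> results ?M ts" unfolding results_def M by blast
    qed
    ultimately show ?thesis by blast
  qed
  then have "implements ?M k \<Gamma> A (\<lambda>x. {ts'. \<exists>ts \<in> A x. F ts = Some ts'})"
    using wf M by (intro implementsI[where p = "p + 1"]) auto
  then show ?thesis using adm unfolding runs_def by blast
qed

text \<open>A path rejects where \<open>g\<close> is undefined, so one rule covers testing a symbol
  as well as writing and moving.\<close>

lemma runs_act:
  assumes adm: "admissible k \<Gamma> A" and k: "i < k" "finite \<Gamma>" "{Blank, Bit False, Bit True} \<subseteq> \<Gamma>"
    and g: "\<And>s a. s \<in> \<Gamma> \<Longrightarrow> g s = Some a \<Longrightarrow> fst a \<in> \<Gamma>"
  shows "runs k \<Gamma> A (\<lambda>x. {ts[i := act a (ts ! i)] | ts a. ts \<in> A x \<and> g (scan (ts ! i)) = Some a})"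
proof -
  define \<delta> where "\<delta> rs = map_option (\<lambda>a. (False, (keep rs)[i := a])) (g (rs ! i))" for rs
  define F where "F ts = map_option (\<lambda>a. ts[i := act a (ts ! i)]) (g (scan (ts ! i)))" for ts
  have act: "map2 act ((keep (map scan ts))[i := a]) ts = ts[i := act a (ts ! i)]" for ts a
  proof (rule nth_equalityI)
    fix j
    assume "j < length (map2 act ((keep (map scan ts))[i := a]) ts)"
    then show "map2 act ((keep (map scan ts))[i := a]) ts ! j = ts[i := act a (ts ! i)] ! j"
      by (cases "i = j") (auto simp: keep_def)
  qed simp
  have "runs k \<Gamma> A (\<lambda>x. {ts'. \<exists>ts \<in> A x. F ts = Some ts'})"
  \<comment> \<open>The flag in \<open>\<delta>\<close> is always \<open>False\<close>, so the loop
    is left before any round is completed.\<close>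
  proof (rule runs_loop[where p = 0 and \<delta> = \<delta>, OF adm _ k(2,3)])
    fix rs b ws
    assume *: "\<delta> rs = Some (b, ws)" "length rs = k" "set rs \<subseteq> \<Gamma>"
    then obtain a where a: "g (rs ! i) = Some a" "ws = (keep rs)[i := a]"
      by (auto simp: \<delta>_def)
    have "fst a \<in> \<Gamma>" using g[OF _ a(1)] * k(1) nth_mem by blast
    moreover have "fst ` set ws \<subseteq> insert (fst a) (fst ` set (keep rs))"
      unfolding a using set_update_subset_insert by fast
    ultimately show "length ws = k \<and> fst ` set ws \<subseteq> \<Gamma>"
      using * a by auto
  next
    fix x ts
    assume "ts \<in> A x"
    then have "length ts = k" using adm tapes_ok_length unfolding admissible_def by blast
    then show "\<exists>n\<le>poly 0 (length x). \<exists>tss. tss 0 = ts \<and>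
      (\<forall>m<n. \<exists>ws. \<delta> (map scan (tss m)) = Some (True, ws) \<and> tss (Suc m) = map2 act ws (tss m)) \<and>
      (case \<delta> (map scan (tss n)) of None \<Rightarrow> F ts = None
        | Some (b, ws) \<Rightarrow> \<not> b \<and> F ts = Some (map2 act ws (tss n)))"
      using k(1) act by (intro exI[of _ 0] conjI exI[of _ "\<lambda>_. ts"])
        (auto simp: \<delta>_def F_def split: option.split)
  qed (use k in auto)
  moreover have "{ts'. \<exists>ts \<in> A x. F ts = Some ts'} =
      {ts[i := act a (ts ! i)] | ts a. ts \<in> A x \<and> g (scan (ts ! i)) = Some a}" for x
    by (auto simp: F_def)
  ultimately show ?thesis by simp
qed


section \<open>Words on tapes\<close>

text \<open>Describes the word at the head without \<open>LEAST\<close>; the second clause makes it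
  maximal and hence unique.\<close>

definition holds :: "tape \<Rightarrow> bool list \<Rightarrow> bool" where
  "holds t w \<longleftrightarrow> (\<forall>i < length w. fst t (snd t + int i) = Bit (w ! i)) \<and>
     fst t (snd t + int (length w)) \<notin> range Bit"

lemma tape_word_eq:
  assumes "holds t w"
  shows "tape_word t = w"
proof -
  obtain c h where t: "t = (c, h)" by fastforce
  have "(LEAST n. c (h + int n) \<notin> range Bit) = length w"
    using assms unfolding holds_def t
    by (intro Least_equality) (auto simp: not_less[symmetric])
  moreover have "map (\<lambda>i. c (h + int i) = Bit True) [0..<length w] = w"
    using assms unfolding holds_def t by (intro nth_equalityI) auto
  ultimately show ?thesis unfolding t by simp
qed

lemma holds_tape_word:
  assumes "confined n t"
  shows "holds t (tape_word t)"
proof -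
  obtain c h where t: "t = (c, h)" by fastforce
  define l where "l = (LEAST m. c (h + int m) \<notin> range Bit)"
  \<comment> \<open>The first cell to the right of the window, at position \<open>n + 1\<close>, is
    blank; so the \<open>LEAST\<close> in \<open>tape_word\<close> has a witness.\<close>
  have "c (h + int (nat (int n - h + 1))) = Blank"
    using assms unfolding confined_def t by simp
  then have "c (h + int (nat (int n - h + 1))) \<notin> range Bit" by auto
  then have "c (h + int l) \<notin> range Bit" unfolding l_def by (rule LeastI)
  moreover have "c (h + int m) \<in> range Bit" if "m < l" for m
    using that not_less_Least unfolding l_def by blast
  moreover have "tape_word t = map (\<lambda>i. c (h + int i) = Bit True) [0..<l]"
    unfolding t l_def by simp
  ultimately show ?thesis unfolding holds_def t by force
qed

text \<open>All cells of the word lie in a window of \<open>2 * n + 1\<close> cells. The bound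
  \<open>smult 2 p + 1\<close> of the copying loops comes from here.\<close>

lemma length_holds:
  assumes "holds t w" "confined n t"
  shows "length w \<le> 2 * n + 1"
proof (cases "length w")
  case (Suc l)
  then have "fst t (snd t + int l) = Bit (w ! l)" using assms(1) unfolding holds_def by simp
  then have "\<not> int n < \<bar>snd t + int l\<bar>" using assms(2) unfolding confined_def by (metis sym.distinct(1))
  moreover have "\<bar>snd t\<bar> \<le> int n" using assms(2) unfolding confined_def by simp
  ultimately show ?thesis using Suc by linarith
qed simp

lemma holds_Cons:
  "holds t (b # w) \<longleftrightarrow> scan t = Bit b \<and> holds (act (scan t, MoveR) t) w"
proof -
  have "(\<forall>i < length (b # w). fst t (snd t + int i) = Bit ((b # w) ! i)) \<longleftrightarrow>
      fst t (snd t) = Bit b \<and> (\<forall>i < length w. fst t (snd t + 1 + int i) = Bit (w ! i))"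
    by (simp add: All_less_Suc2 add.commute add.left_commute)
  then show ?thesis
    unfolding holds_def act_scan by (simp add: add.assoc scan_eq)
qed

text \<open>Tapes are infinite to the left, so there is always a cell to overwrite; what it held was
  not part of the word, which starts at the head.\<close>

definition prepend :: "bool \<Rightarrow> tape \<Rightarrow> tape" where
  "prepend b t = act (Bit b, Stay) (act (scan t, MoveL) t)"

lemma holds_prepend:
  assumes "holds t w"
  shows "holds (prepend b t) (b # w)"
  using assms unfolding holds_Cons prepend_def by (simp add: act_eq scan_eq holds_def)

text \<open>Preserves the invariant of the writing loop: a bit put behind a prefix of the word gives
  the next prefix.\<close>

lemma input_tape_snoc:
  "input_tape (w @ [b]) = ((fst (input_tape w))(int (length w) := Bit b), 0)"
  by (auto simp: input_tape_def nth_append fun_eq_iff)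

lemma input_tape_Nil: "input_tape [] = blank_tape"
  by (simp add: input_tape_def blank_tape_def fun_eq_iff)

lemma snd_input_tape [simp]: "snd (input_tape w) = 0"
  by (simp add: input_tape_def)


section \<open>Copying words\<close>

text \<open>Each target becomes a genuine input tape with its head at 0, so that a machine can be
  started on it. The source head ends up just behind the word.\<close>

definition copy_word :: "nat \<Rightarrow> nat set \<Rightarrow> tape list \<Rightarrow> tape list" where
  "copy_word i J ts = (let w = tape_word (ts ! i) in
     map (\<lambda>j. if j = i then (fst (ts ! i), snd (ts ! i) + int (length w))
              else if j \<in> J then input_tape w else ts ! j) [0..<length ts])"

text \<open>The stage before rewinding. The target heads stand on the last bit written; for the
  empty word this is the blank cell at -1.\<close>

definition write_word :: "nat \<Rightarrow> nat set \<Rightarrow> tape list \<Rightarrow> tape list" where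
  "write_word i J ts = (let w = tape_word (ts ! i) in
     map (\<lambda>j. if j = i then (fst (ts ! i), snd (ts ! i) + int (length w))
              else if j \<in> J then (fst (input_tape w), int (length w) - 1) else ts ! j) [0..<length ts])"

lemma runs_write_word:
  assumes adm: "admissible k \<Gamma> A" and k: "finite \<Gamma>" "{Blank, Bit False, Bit True} \<subseteq> \<Gamma>"
    and i: "i < k" "i \<notin> J"
    and blank: "\<And>x ts j. ts \<in> A x \<Longrightarrow> j \<in> J \<Longrightarrow> j < k \<Longrightarrow> ts ! j = blank_tape"
  shows "runs k \<Gamma> A (\<lambda>x. write_word i J ` A x)"
proof -
  define \<delta> where "\<delta> rs = (if rs ! i \<in> range Bit
      then Some (True, map (\<lambda>j. if j = i then (rs ! j, MoveR) else if j \<in> J then (rs ! i, MoveR)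
        else (rs ! j, Stay)) [0..<k])
      else Some (False, map (\<lambda>j. if j \<in> J then (rs ! j, MoveL) else (rs ! j, Stay)) [0..<k]))" for rs
  obtain p :: "nat poly" where p: "\<And>x ts. ts \<in> A x \<Longrightarrow> tapes_ok k \<Gamma> (poly p (length x)) ts"
    using adm unfolding admissible_def by blast
  have "runs k \<Gamma> A (\<lambda>x. {ts'. \<exists>ts \<in> A x. Some (write_word i J ts) = Some ts'})"
  proof (rule runs_loop[where p = "smult 2 p + 1" and \<delta> = \<delta>, OF adm _ k])
    fix rs b ws
    assume *: "\<delta> rs = Some (b, ws)" "length rs = k" "set rs \<subseteq> \<Gamma>"
    then have mem: "rs ! j \<in> \<Gamma>" if "j < k" for j using that nth_mem by blast
    show "length ws = k \<and> fst ` set ws \<subseteq> \<Gamma>"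
    proof (cases "rs ! i \<in> range Bit")
      case True
      then have "ws = map (\<lambda>j. if j = i then (rs ! j, MoveR) else if j \<in> J then (rs ! i, MoveR)
          else (rs ! j, Stay)) [0..<k]"
        using *(1) by (simp only: \<delta>_def if_True option.inject prod.inject)
      then show ?thesis using mem i by auto
    next
      case False
      then have "ws = map (\<lambda>j. if j \<in> J then (rs ! j, MoveL) else (rs ! j, Stay)) [0..<k]"
        using *(1) by (simp only: \<delta>_def if_False option.inject prod.inject)
      then show ?thesis using mem by auto
    qed
  next
    fix x ts
    assume A: "ts \<in> A x"
    define w where "w = tape_word (ts ! i)"
    have len: "length ts = k" and conf: "confined (poly p (length x)) (ts ! i)"
      using p[OF A] i(1) unfolding tapes_ok_def by auto
    have w: "holds (ts ! i) w" unfolding w_def using holds_tape_word[OF conf] .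
    define tss where "tss m = map (\<lambda>j. if j = i then (fst (ts ! i), snd (ts ! i) + int m)
        else if j \<in> J then (fst (input_tape (take m w)), int m) else ts ! j) [0..<k]" for m
    have tss0: "tss 0 = ts"
      using blank[OF A] len
      by (intro nth_equalityI) (auto simp: tss_def input_tape_Nil blank_tape_def)
    have scan_i: "map scan (tss m) ! i = fst (ts ! i) (snd (ts ! i) + int m)" for m
      using i by (simp add: tss_def)
    have nextround: "\<exists>ws. \<delta> (map scan (tss m)) = Some (True, ws) \<and> tss (Suc m) = map2 act ws (tss m)"
      if m: "m < length w" for m
    proof -
      have bit: "map scan (tss m) ! i = Bit (w ! m)"
        using w m unfolding scan_i holds_def by simp
      let ?ws = "map (\<lambda>j. if j = i then (map scan (tss m) ! j, MoveR)
        else if j \<in> J then (map scan (tss m) ! i, MoveR)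
        else (map scan (tss m) ! j, Stay)) [0..<k]"
      have "\<delta> (map scan (tss m)) = Some (True, ?ws)"
        unfolding \<delta>_def by (simp only: bit rangeI if_True)
      moreover have "tss (Suc m) = map2 act ?ws (tss m)"
      proof (rule nth_equalityI)
        fix j
        assume "j < length (tss (Suc m))"
        then have j: "j < k" by (simp add: tss_def)
        have wm: "take (Suc m) w = take m w @ [w ! m]" "length (take m w) = m"
          using m by (auto simp: take_Suc_conv_app_nth)
        have "act (Bit (w ! m), MoveR) (fst (input_tape (take m w)), int m) =
            (fst (input_tape (take (Suc m) w)), int (Suc m))"
          unfolding wm(1) input_tape_snoc using wm(2) by simp
        then show "tss (Suc m) ! j = map2 act ?ws (tss m) ! j"
          using j bit by (auto simp: tss_def act_eq scan_eq)
      qed (simp add: tss_def)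
      ultimately show ?thesis by blast
    qed
    have stop: "map scan (tss (length w)) ! i \<notin> range Bit"
      using w unfolding scan_i holds_def by simp
    let ?n = "length w"
    let ?ws = "map (\<lambda>j. if j \<in> J then (map scan (tss ?n) ! j, MoveL) else (map scan (tss ?n) ! j, Stay)) [0..<k]"
    have \<delta>n: "\<delta> (map scan (tss ?n)) = Some (False, ?ws)"
      unfolding \<delta>_def by (simp only: stop if_False)
    have "write_word i J ts = map2 act ?ws (tss ?n)"
    proof (rule nth_equalityI)
      fix j
      assume "j < length (write_word i J ts)"
      then have j: "j < k" using len by (simp add: write_word_def Let_def)
      then show "write_word i J ts ! j = map2 act ?ws (tss ?n) ! j"
        using len i(2) by (auto simp: tss_def write_word_def Let_def w_def[symmetric] act_eq scan_eq)
    qed (simp add: tss_def write_word_def Let_def len)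
    moreover have "length w \<le> poly (smult 2 p + 1) (length x)"
      using length_holds[OF w conf] by simp
    ultimately show "\<exists>n\<le>poly (smult 2 p + 1) (length x). \<exists>tss. tss 0 = ts \<and>
      (\<forall>m<n. \<exists>ws. \<delta> (map scan (tss m)) = Some (True, ws) \<and> tss (Suc m) = map2 act ws (tss m)) \<and>
      (case \<delta> (map scan (tss n)) of None \<Rightarrow> Some (write_word i J ts) = None
        | Some (b, ws) \<Rightarrow> \<not> b \<and> Some (write_word i J ts) = Some (map2 act ws (tss n)))"
      using \<delta>n nextround tss0 by (intro exI[of _ ?n] conjI exI[of _ tss]) auto
  qed (use i in auto)
  moreover have "{ts'. \<exists>ts \<in> A x. Some (write_word i J ts) = Some ts'} = write_word i J ` A x" for x
    by auto
  ultimately show ?thesis by simp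
qed

definition rewind :: "nat set \<Rightarrow> tape list \<Rightarrow> tape list" where
  "rewind J us = map (\<lambda>j. if j \<in> J then (fst (us ! j), 0) else us ! j) [0..<length us]"

lemma rewind_write_word:
  assumes "i \<notin> J"
  shows "rewind J (write_word i J ts) = copy_word i J ts"
  using assms unfolding rewind_def write_word_def copy_word_def
  by (intro nth_equalityI) (auto simp: Let_def input_tape_def)

text \<open>The rewinding loop goes left until it meets the blank cell at -1 and then steps right.
  All targets have equal contents and move in unison, so it suffices to watch the single tape
  \<open>j0\<close>.\<close>

lemma runs_copy_word:
  assumes adm: "admissible k \<Gamma> A" and k: "finite \<Gamma>" "{Blank, Bit False, Bit True} \<subseteq> \<Gamma>"
    and i: "i < k" "i \<notin> J" and j0: "j0 \<in> J" "j0 < k"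
    and blank: "\<And>x ts j. ts \<in> A x \<Longrightarrow> j \<in> J \<Longrightarrow> j < k \<Longrightarrow> ts ! j = blank_tape"
  shows "runs k \<Gamma> A (\<lambda>x. copy_word i J ` A x)"
proof -
  define \<delta> where "\<delta> rs = Some (rs ! j0 \<in> range Bit,
      map (\<lambda>j. (rs ! j, if j \<in> J then if rs ! j0 \<in> range Bit then MoveL else MoveR else Stay))
        [0..<k])" for rs
  obtain p :: "nat poly" where p: "\<And>x ts. ts \<in> A x \<Longrightarrow> tapes_ok k \<Gamma> (poly p (length x)) ts"
    using adm unfolding admissible_def by blast
  let ?B = "\<lambda>x. write_word i J ` A x"
  have wr: "runs k \<Gamma> A ?B"
    using runs_write_word[OF adm k i blank] .
  have "runs k \<Gamma> ?B (\<lambda>x. {ts'. \<exists>us \<in> ?B x. Some (rewind J us) = Some ts'})"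
  proof (rule runs_loop[where p = "smult 2 p + 1" and \<delta> = \<delta>, OF admissible_runs[OF wr] _ k])
    fix rs b ws
    assume *: "\<delta> rs = Some (b, ws)" "length rs = k" "set rs \<subseteq> \<Gamma>"
    then have "rs ! j \<in> \<Gamma>" if "j < k" for j using that nth_mem by blast
    with * show "length ws = k \<and> fst ` set ws \<subseteq> \<Gamma>"
      by (auto simp: \<delta>_def)
  next
    fix x us
    assume "us \<in> ?B x"
    then obtain ts where A: "ts \<in> A x" and us: "us = write_word i J ts" by blast
    define w where "w = tape_word (ts ! i)"
    have len: "length ts = k" and conf: "confined (poly p (length x)) (ts ! i)"
      using p[OF A] i(1) unfolding tapes_ok_def by auto
    have w: "holds (ts ! i) w" unfolding w_def using holds_tape_word[OF conf] .
    have lenu: "length us = k" by (simp add: us write_word_def Let_def len)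
    have usJ: "us ! j = (fst (input_tape w), int (length w) - 1)" if "j \<in> J" "j < k" for j
      using that i(2) len by (auto simp: us write_word_def Let_def w_def)
    define tss where "tss m = map (\<lambda>j. if j \<in> J
        then (fst (input_tape w), int (length w) - 1 - int m) else us ! j) [0..<k]" for m
    have tss0: "tss 0 = us"
      using usJ lenu by (intro nth_equalityI) (auto simp: tss_def)
    have scan_j0: "map scan (tss m) ! j0 = fst (input_tape w) (int (length w) - 1 - int m)" for m
      using j0 by (simp add: tss_def)
    let ?n = "length w"
    let ?ws = "\<lambda>m d. map (\<lambda>j. (map scan (tss m) ! j, if j \<in> J then d else Stay)) [0..<k]"
    have nextround: "\<exists>ws. \<delta> (map scan (tss m)) = Some (True, ws) \<and> tss (Suc m) = map2 act ws (tss m)"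
      if m: "m < ?n" for m
    proof -
      have "map scan (tss m) ! j0 \<in> range Bit"
        using m unfolding scan_j0 by (simp add: input_tape_def)
      then have "\<delta> (map scan (tss m)) = Some (True, ?ws m MoveL)"
        unfolding \<delta>_def by simp
      moreover have "tss (Suc m) = map2 act (?ws m MoveL) (tss m)"
        by (rule nth_equalityI) (auto simp: tss_def act_eq scan_eq)
      ultimately show ?thesis by blast
    qed
    have "map scan (tss ?n) ! j0 \<notin> range Bit"
      unfolding scan_j0 by (auto simp: input_tape_def)
    then have \<delta>n: "\<delta> (map scan (tss ?n)) = Some (False, ?ws ?n MoveR)"
      unfolding \<delta>_def by simp
    have rew: "rewind J us = map2 act (?ws ?n MoveR) (tss ?n)"
      using usJ by (intro nth_equalityI) (auto simp: tss_def rewind_def lenu act_eq scan_eq)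
    have "length w \<le> poly (smult 2 p + 1) (length x)"
      using length_holds[OF w conf] by simp
    then show "\<exists>n\<le>poly (smult 2 p + 1) (length x). \<exists>tss. tss 0 = us \<and>
      (\<forall>m<n. \<exists>ws. \<delta> (map scan (tss m)) = Some (True, ws) \<and> tss (Suc m) = map2 act ws (tss m)) \<and>
      (case \<delta> (map scan (tss n)) of None \<Rightarrow> Some (rewind J us) = None
        | Some (b, ws) \<Rightarrow> \<not> b \<and> Some (rewind J us) = Some (map2 act ws (tss n)))"
      using \<delta>n nextround tss0 rew by (intro exI[of _ ?n] conjI exI[of _ tss]) auto
  qed (use i in auto)
  moreover have "{ts'. \<exists>us \<in> ?B x. Some (rewind J us) = Some ts'} = copy_word i J ` A x" for x
    using rewind_write_word[OF i(2)] by auto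
  ultimately have "runs k \<Gamma> ?B (\<lambda>x. copy_word i J ` A x)" by simp
  with wr show ?thesis by (rule runs_seq)
qed


section \<open>From programs to languages and functions\<close>

lemma runs_initialE:
  assumes "runs k \<Gamma> (\<lambda>x. {initial k x}) B"
  obtains M :: tm where "wf_tm M" "poly_time M" "\<And>x. snd ` accepting_configs M x = B x"
proof -
  obtain M :: tm and p where M: "wf_tm M" "tapes M = k" "\<And>x. halts_within M (initial k x) (poly p (length x))"
    "\<And>x. B x = results M (initial k x)"
  proof -
    obtain M p where "implements M k \<Gamma> (\<lambda>x. {initial k x}) B"
      "\<forall>x. \<forall>ts \<in> {initial k x}. halts_within M ts (poly p (length x))"
      using assms unfolding runs_def implements_def by blast
    then show thesis using that[of M p] by (simp add: implements_def)
  qed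
  show thesis
  proof
    show "wf_tm M" by fact
    show "poly_time M" unfolding poly_time_iff using M by blast
    show "snd ` accepting_configs M x = B x" for x unfolding snd_accepting_configs using M by simp
  qed
qed

lemma NP_I:
  assumes "runs k \<Gamma> (\<lambda>x. {initial k x}) B"
  shows "{x. B x \<noteq> {}} \<in> NP"
proof -
  obtain M :: tm where M: "wf_tm M" "poly_time M" "\<And>x. snd ` accepting_configs M x = B x"
    using runs_initialE[OF assms] by blast
  have "x \<in> {x. B x \<noteq> {}} \<longleftrightarrow> accepting_configs M x \<noteq> {}" for x
    using M(3)[of x] by auto
  with M(1,2) show ?thesis unfolding NP_def by blast
qed

lemma NPSV_t_I:
  assumes "runs k \<Gamma> (\<lambda>x. {initial k x}) B"
    and "\<And>x. B x \<noteq> {}" "\<And>x ts. ts \<in> B x \<Longrightarrow> tape_word (last ts) = f x"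
  shows "f \<in> NPSV_t"
proof -
  obtain M :: tm where M: "wf_tm M" "poly_time M" "\<And>x. snd ` accepting_configs M x = B x"
    using runs_initialE[OF assms(1)] by blast
  have "accepting_configs M x \<noteq> {} \<and> (\<forall>c \<in> accepting_configs M x. output_word c = f x)" for x
    using M(3)[of x] assms(2)[of x] assms(3)[of _ x] unfolding output_word_def by blast
  with M(1,2) show ?thesis unfolding NPSV_t_def by blast
qed

lemma wf_tm_basics:
  assumes "wf_tm M"
  shows "1 \<le> tapes M" "finite (alphabet M)" "{Blank, Bit False, Bit True} \<subseteq> alphabet M"
  using assms by (simp_all add: wf_tm_def)

lemma admissible_initial:
  assumes "{Blank, Bit False, Bit True} \<subseteq> \<Gamma>" "1 \<le> k"
  shows "admissible k \<Gamma> (\<lambda>x. {initial k x})"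
  unfolding admissible_def using tapes_ok_initial[OF assms] by (intro exI[of _ "[:0, 1:]"]) simp

text \<open>Concatenation of languages over tapes as letters: independent computations on
  neighbouring blocks combine all their outcomes, and nothing remains as soon as one of them has no
  accepting path.\<close>

definition conc :: "'a list set \<Rightarrow> 'a list set \<Rightarrow> 'a list set" where
  "conc P R = {p @ r | p r. p \<in> P \<and> r \<in> R}"

lemma conc_empty_iff: "conc P R = {} \<longleftrightarrow> P = {} \<or> R = {}"
  by (auto simp: conc_def)

text \<open>\<open>P\<close> holds the blocks already computed and \<open>post\<close> those still
  waiting, so repeated use works through a row of blocks from left to right. The block of
  \<open>M\<close> holds \<open>x\<close> itself, so its time bound applies as it stands.\<close>

lemma runs_block:
  fixes M :: tm
  assumes wf: "wf_tm M" "alphabet M \<subseteq> \<Gamma>" "finite \<Gamma>" and "poly_time M"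
    and adm: "admissible k \<Gamma> (\<lambda>x. {p @ initial (tapes M) x @ post x | p. p \<in> P x})"
    and len: "\<And>x p. p \<in> P x \<Longrightarrow> length p = a" "\<And>x. length (post x) = b" "k = a + tapes M + b"
  shows "runs k \<Gamma> (\<lambda>x. {p @ initial (tapes M) x @ post x | p. p \<in> P x})
    (\<lambda>x. {p @ post x | p. p \<in> conc (P x) (results M (initial (tapes M) x))})"
proof -
  define D where "D x = {(p, initial (tapes M) x, post x) | p. p \<in> P x}" for x
  obtain r where r: "\<And>x. halts_within M (initial (tapes M) x) (poly r (length x))"
    using assms(4) unfolding poly_time_iff by blast
  have 1: "1 \<le> tapes M" using wf_tm_basics[OF wf(1)] by simp
  have A: "{pre @ ts @ post | pre ts post. (pre, ts, post) \<in> D x} =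
      {p @ initial (tapes M) x @ post x | p. p \<in> P x}" for x
    by (auto simp: D_def)
  have B: "{pre @ ts' @ post | pre ts ts' post. (pre, ts, post) \<in> D x \<and> ts' \<in> results M ts} =
      {p @ post x | p. p \<in> conc (P x) (results M (initial (tapes M) x))}" for x
  proof -
    have "{pre @ ts' @ post | pre ts ts' post. (pre, ts, post) \<in> D x \<and> ts' \<in> results M ts} =
        {p @ ts' @ post x | p ts'. p \<in> P x \<and> ts' \<in> results M (initial (tapes M) x)}"
      by (auto simp: D_def)
    also have "\<dots> = {(p @ ts') @ post x | p ts'. p \<in> P x \<and> ts' \<in> results M (initial (tapes M) x)}"
      by simp
    also have "\<dots> = {p @ post x | p. p \<in> conc (P x) (results M (initial (tapes M) x))}"
      unfolding conc_def by blast
    finally show ?thesis .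
  qed
  have "runs (a + tapes M + b) \<Gamma> (\<lambda>x. {pre @ ts @ post | pre ts post. (pre, ts, post) \<in> D x})
    (\<lambda>x. {pre @ ts' @ post | pre ts ts' post. (pre, ts, post) \<in> D x \<and> ts' \<in> results M ts})"
  proof (rule runs_lift[OF wf, where p = r])
    show "admissible (a + tapes M + b) \<Gamma> (\<lambda>x. {pre @ ts @ post | pre ts post. (pre, ts, post) \<in> D x})"
      unfolding A using adm len(3) by simp
  qed (use r 1 len in \<open>auto simp: D_def initial_def\<close>)
  then show ?thesis unfolding A B len(3) .
qed

text \<open>Brings machines with different numbers of tapes to a common format: blank tapes on the
  right turn initial tapes of \<open>M\<close> into initial tapes for the larger number.\<close>

lemma runs_pad:
  fixes M :: tm
  assumes wf: "wf_tm M" "alphabet M \<subseteq> \<Gamma>" "finite \<Gamma>" and poly: "poly_time M"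
  shows "runs (tapes M + b) \<Gamma> (\<lambda>x. {initial (tapes M + b) x})
    (\<lambda>x. {ts @ replicate b blank_tape | ts. ts \<in> results M (initial (tapes M) x)})"
proof -
  have 1: "1 \<le> tapes M" using wf_tm_basics[OF wf(1)] by simp
  then have "initial (tapes M) x @ replicate b blank_tape = initial (tapes M + b) x" for x
    by (simp add: initial_def replicate_add[symmetric])
  then have A: "{p @ initial (tapes M) x @ replicate b blank_tape | p. p \<in> {[]}} =
      {initial (tapes M + b) x}" for x
    by simp
  have B: "conc {[]} R = R" for R :: "tape list set"
    by (simp add: conc_def)
  have "admissible (tapes M + b) \<Gamma> (\<lambda>x. {initial (tapes M + b) x})"
    using 1 wf_tm_basics(3)[OF wf(1)] wf(2) by (intro admissible_initial) auto
  then have "admissible (tapes M + b) \<Gamma>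
      (\<lambda>x. {p @ initial (tapes M) x @ replicate b blank_tape | p. p \<in> {[]}})"
    unfolding A .
  from runs_block[OF wf poly this, of 0 b] show ?thesis
    unfolding A B by simp
qed

lemma NP_machineE:
  assumes "L \<in> NP"
  obtains M :: tm where "wf_tm M" "poly_time M" "\<And>x. x \<in> L \<longleftrightarrow> results M (initial (tapes M) x) \<noteq> {}"
  using assms unfolding NP_def snd_accepting_configs[symmetric] by auto

lemma NP_Un:
  assumes "L1 \<in> NP" "L2 \<in> NP"
  shows "L1 \<union> L2 \<in> NP"
proof -
  obtain M1 :: tm where M1: "wf_tm M1" "poly_time M1"
    "\<And>x. x \<in> L1 \<longleftrightarrow> results M1 (initial (tapes M1) x) \<noteq> {}" using NP_machineE[OF assms(1)] by blast
  obtain M2 :: tm where M2: "wf_tm M2" "poly_time M2"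
    "\<And>x. x \<in> L2 \<longleftrightarrow> results M2 (initial (tapes M2) x) \<noteq> {}" using NP_machineE[OF assms(2)] by blast
  let ?\<Gamma> = "alphabet M1 \<union> alphabet M2"
  have fin: "finite ?\<Gamma>" using wf_tm_basics(2)[OF M1(1)] wf_tm_basics(2)[OF M2(1)] by simp
  \<comment> \<open>\<open>runs_Un\<close> needs a common starting family, so each machine gets as
    many extra tapes as the other one has.\<close>
  note runs_Un[OF runs_pad[OF M1(1) _ fin M1(2), of "tapes M2"]
      runs_pad[OF M2(1) _ fin M2(2), of "tapes M1", unfolded add.commute[of "tapes M2"]], simplified]
  from NP_I[OF this] have "{x. results M1 (initial (tapes M1) x) \<noteq> {} \<or>
      results M2 (initial (tapes M2) x) \<noteq> {}} \<in> NP"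
    by (rule back_subst[where P = "\<lambda>L. L \<in> NP"]) auto
  moreover have "{x. results M1 (initial (tapes M1) x) \<noteq> {} \<or>
      results M2 (initial (tapes M2) x) \<noteq> {}} = L1 \<union> L2" using M1(3) M2(3) by blast
  ultimately show ?thesis by simp
qed


section \<open>Inclusion in DP\<close>

definition strip :: "bool set \<Rightarrow> bool list \<Rightarrow> bool list option" where
  "strip S w = (case w of [] \<Rightarrow> None | a # v \<Rightarrow> if a \<in> S then Some v else None)"

text \<open>Moving the head right removes the bit from the word without changing the contents of the
  tape. For \<open>S = UNIV\<close> any bit passes, but the end of the word still rejects.\<close>

definition read_bit :: "nat \<Rightarrow> bool set \<Rightarrow> family \<Rightarrow> family" where
  "read_bit i S A x =
     {ts[i := act (scan (ts ! i), MoveR) (ts ! i)] | ts. ts \<in> A x \<and> scan (ts ! i) \<in> Bit ` S}"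

lemma runs_read_bit:
  assumes "admissible k \<Gamma> A" "i < k" "finite \<Gamma>" "{Blank, Bit False, Bit True} \<subseteq> \<Gamma>"
  shows "runs k \<Gamma> A (read_bit i S A)"
proof -
  let ?g = "\<lambda>s. if s \<in> Bit ` S then Some (s, MoveR) else None"
  have "runs k \<Gamma> A (\<lambda>x. {ts[i := act a (ts ! i)] | ts a. ts \<in> A x \<and> ?g (scan (ts ! i)) = Some a})"
    by (rule runs_act[OF assms]) (auto split: if_splits)
  moreover have "{ts[i := act a (ts ! i)] | ts a. ts \<in> A x \<and> ?g (scan (ts ! i)) = Some a} =
      read_bit i S A x" for x
    unfolding read_bit_def by (auto split: if_splits)
  ultimately show ?thesis by simp
qed

text \<open>Abstracts from the tapes to the one word that all surviving paths share on tape
  \<open>i\<close>, with \<open>None\<close> if no path survives. The tapes from \<open>m\<close> on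
  are reserved for a later machine and so have to stay blank.\<close>

definition carries :: "nat \<Rightarrow> nat \<Rightarrow> nat \<Rightarrow> family \<Rightarrow> (bool list \<Rightarrow> bool list option) \<Rightarrow> bool" where
  "carries i m k A V \<longleftrightarrow> (\<forall>x. (A x = {} \<longleftrightarrow> V x = None) \<and>
     (\<forall>ts \<in> A x. length ts = k \<and> holds (ts ! i) (the (V x)) \<and>
        (\<forall>j. m \<le> j \<longrightarrow> j < k \<longrightarrow> ts ! j = blank_tape)))"

text \<open>As all paths carry the same word, either all pass the test or all reject;
  \<open>holds_Cons\<close> identifies the word left after the move.\<close>

lemma carries_read_bit:
  assumes A: "carries i m k A V" and i: "i < m" "m \<le> k"
  shows "carries i m k (read_bit i S A) (\<lambda>x. Option.bind (V x) (strip S))"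
  unfolding carries_def
proof (intro allI)
  fix x
  have V: "A x = {} \<longleftrightarrow> V x = None" using A unfolding carries_def by blast
  have ts: "length ts = k \<and> holds (ts ! i) (the (V x)) \<and>
      (\<forall>j. m \<le> j \<longrightarrow> j < k \<longrightarrow> ts ! j = blank_tape)" if "ts \<in> A x" for ts
    using A that unfolding carries_def by blast
  show "(read_bit i S A x = {} \<longleftrightarrow> Option.bind (V x) (strip S) = None) \<and>
     (\<forall>ts \<in> read_bit i S A x. length ts = k \<and> holds (ts ! i) (the (Option.bind (V x) (strip S))) \<and>
        (\<forall>j. m \<le> j \<longrightarrow> j < k \<longrightarrow> ts ! j = blank_tape))"
  proof (cases "\<exists>a w. V x = Some (a # w) \<and> a \<in> S")
    case True
    then obtain a w where w: "V x = Some (a # w)" "a \<in> S" by blast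
    have h: "scan (ts ! i) = Bit a \<and> holds (act (scan (ts ! i), MoveR) (ts ! i)) w"
      if "ts \<in> A x" for ts
      using ts[OF that] unfolding w(1) option.sel holds_Cons by blast
    have bind: "Option.bind (V x) (strip S) = Some w" using w by (simp add: strip_def)
    have "A x \<noteq> {}" using V w by simp
    then have "read_bit i S A x \<noteq> {}" unfolding read_bit_def using h w(2) by blast
    moreover have "length us = k \<and> holds (us ! i) w \<and> (\<forall>j. m \<le> j \<longrightarrow> j < k \<longrightarrow> us ! j = blank_tape)"
      if us: "us \<in> read_bit i S A x" for us
    proof -
      obtain ts0 where t: "us = ts0[i := act (scan (ts0 ! i), MoveR) (ts0 ! i)]" "ts0 \<in> A x"
        using us unfolding read_bit_def by blast
      show ?thesis using ts[OF t(2)] h[OF t(2)] i unfolding t(1) by auto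
    qed
    ultimately show ?thesis unfolding bind by simp
  next
    case False
    have "scan (ts ! i) \<notin> Bit ` S" if t: "ts \<in> A x" for ts
    proof
      assume "scan (ts ! i) \<in> Bit ` S"
      then obtain a where a: "scan (ts ! i) = Bit a" "a \<in> S" by blast
      obtain w where w: "V x = Some w" using t V by auto
      have "holds (ts ! i) w" using ts[OF t] w by simp
      then have "\<exists>v. w = a # v"
        using a(1) holds_Cons by (cases w) (auto simp: holds_def scan_eq)
      then show False using False w a(2) by blast
    qed
    then have "read_bit i S A x = {}" unfolding read_bit_def by blast
    moreover have "Option.bind (V x) (strip S) = None"
      using False by (cases "V x") (auto simp: strip_def split: list.split)
    ultimately show ?thesis by simp
  qed
qed

text \<open>The output of the machine for \<open>f\<close> is tested bit by bit, and its rest is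
  copied to a fresh block on which the machine for \<open>B\<close> runs. With each of
  \<open>S\<close> and \<open>T\<close> a singleton or \<open>UNIV\<close>, this yields all the
  conditions needed for DP.\<close>

lemma NP_prefix:
  assumes f: "f \<in> NPSV_t" and B: "B \<in> NP"
  shows "{x. \<exists>a b y. f x = a # b # y \<and> a \<in> S \<and> b \<in> T \<and> y \<in> B} \<in> NP"
proof -
  obtain F :: tm where F: "wf_tm F" "poly_time F" and acc: "\<And>x. accepting_configs F x \<noteq> {}"
    and out: "\<And>x c. c \<in> accepting_configs F x \<Longrightarrow> output_word c = f x"
    using f unfolding NPSV_t_def by blast
  obtain N :: tm where N: "wf_tm N" "poly_time N"
    "\<And>y. y \<in> B \<longleftrightarrow> results N (initial (tapes N) y) \<noteq> {}" using NP_machineE[OF B] by blast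
  obtain pN where pN: "\<And>y. halts_within N (initial (tapes N) y) (poly pN (length y))"
    using N(2) unfolding poly_time_iff by blast
  \<comment> \<open>\<open>i\<close> is the output tape of \<open>F\<close>, its last one; the tapes
    from \<open>tapes F\<close> on are those of \<open>N\<close>.\<close>
  define k \<Gamma> i where "k = tapes F + tapes N" and "\<Gamma> = alphabet F \<union> alphabet N" and "i = tapes F - 1"
  have tapes: "1 \<le> tapes F" "1 \<le> tapes N" using wf_tm_basics(1) F(1) N(1) by blast+
  have \<Gamma>: "finite \<Gamma>" "{Blank, Bit False, Bit True} \<subseteq> \<Gamma>" "alphabet F \<subseteq> \<Gamma>" "alphabet N \<subseteq> \<Gamma>"
    using wf_tm_basics[OF F(1)] wf_tm_basics[OF N(1)] by (auto simp: \<Gamma>_def)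
  have ik: "i < k" "i < tapes F" "tapes F \<le> k" "tapes F < k" using tapes by (auto simp: i_def k_def)
  define A1 where "A1 x = {ts @ replicate (tapes N) blank_tape | ts. ts \<in> results F (initial (tapes F) x)}" for x
  define A2 where "A2 = read_bit i S A1"
  define A3 where "A3 = read_bit i T A2"
  define A4 where "A4 x = copy_word i {tapes F} ` A3 x" for x
  define V where "V x = Option.bind (Option.bind (Some (f x)) (strip S)) (strip T)" for x
  have run1: "runs k \<Gamma> (\<lambda>x. {initial k x}) A1"
    unfolding k_def A1_def using runs_pad[OF F(1) \<Gamma>(3,1) F(2)] .
  have run2: "runs k \<Gamma> A1 A2"
    unfolding A2_def using runs_read_bit[OF admissible_runs[OF run1] ik(1) \<Gamma>(1,2)] .
  have run3: "runs k \<Gamma> A2 A3"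
    unfolding A3_def using runs_read_bit[OF admissible_runs[OF run2] ik(1) \<Gamma>(1,2)] .
  have "carries i (tapes F) k A1 (\<lambda>x. Some (f x))"
    unfolding carries_def
  proof (intro allI conjI ballI impI)
    show "A1 x = {} \<longleftrightarrow> Some (f x) = None" for x
      using acc[of x] unfolding A1_def snd_accepting_configs[symmetric] by auto
    fix x ts
    assume ts: "ts \<in> A1 x"
    then obtain us where us: "ts = us @ replicate (tapes N) blank_tape" "us \<in> results F (initial (tapes F) x)"
      unfolding A1_def by blast
    obtain n where ok: "tapes_ok k \<Gamma> n ts"
      using admissible_runs[OF run1] ts unfolding admissible_def by blast
    show "length ts = k" using tapes_ok_length[OF ok] .
    then have len: "length us = tapes F" by (simp add: us k_def)
    have "tape_word (last us) = f x"
      using us(2) out unfolding snd_accepting_configs[symmetric] output_word_def by blast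
    moreover have "last us = ts ! i"
    proof -
      have "us \<noteq> []" using len tapes by auto
      then show ?thesis using len us(1) tapes by (simp add: i_def last_conv_nth nth_append)
    qed
    moreover have "confined n (ts ! i)" using ok ik unfolding tapes_ok_def by simp
    ultimately show "holds (ts ! i) (the (Some (f x)))" using holds_tape_word by fastforce
    show "ts ! j = blank_tape" if "tapes F \<le> j" "j < k" for j
      using that len by (simp add: us nth_append k_def)
  qed
  then have carries3: "carries i (tapes F) k A3 V"
    unfolding V_def A2_def A3_def using ik by (intro carries_read_bit)
  then have A3: "A3 x = {} \<longleftrightarrow> V x = None"
    "ts \<in> A3 x \<Longrightarrow> length ts = k \<and> holds (ts ! i) (the (V x)) \<and>
        (\<forall>j. tapes F \<le> j \<longrightarrow> j < k \<longrightarrow> ts ! j = blank_tape)" for x ts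
    unfolding carries_def by blast+
  have run4: "runs k \<Gamma> A3 A4"
    unfolding A4_def using runs_copy_word[OF admissible_runs[OF run3] \<Gamma>(1,2), of i "{tapes F}" "tapes F"] ik A3(2)
    by auto
  have A4: "length ts = k \<and> drop (tapes F) ts = initial (tapes N) (the (V x))"
    if ts: "ts \<in> A4 x" for x ts
  proof -
    obtain us where us: "us \<in> A3 x" "ts = copy_word i {tapes F} us"
      using ts unfolding A4_def by blast
    note u = A3(2)[OF us(1)]
    have w: "tape_word (us ! i) = the (V x)" using tape_word_eq u by blast
    have len: "length ts = k" using u by (simp add: us(2) copy_word_def Let_def)
    moreover have "drop (tapes F) ts = initial (tapes N) (the (V x))"
    proof (rule nth_equalityI)
      show "length (drop (tapes F) ts) = length (initial (tapes N) (the (V x)))"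
        using tapes len by (simp add: initial_def k_def)
      fix j
      assume "j < length (drop (tapes F) ts)"
      then have "j < tapes N" using len by (simp add: k_def)
      then show "drop (tapes F) ts ! j = initial (tapes N) (the (V x)) ! j"
        using u ik w len by (cases j) (auto simp: us(2) copy_word_def Let_def initial_def k_def i_def)
    qed
    ultimately show ?thesis by blast
  qed
  obtain p :: "nat poly" where p: "\<And>x ts. ts \<in> A3 x \<Longrightarrow> tapes_ok k \<Gamma> (poly p (length x)) ts"
    using admissible_runs[OF run3] unfolding admissible_def by blast
  define q where "q = smult 2 p + 1"
  have long: "length (the (V x)) \<le> poly q (length x)" if ts: "ts \<in> A4 x" for x ts
  proof -
    obtain us where us: "us \<in> A3 x" using ts unfolding A4_def by blast
    have "confined (poly p (length x)) (us ! i)"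
      using p[OF us] ik unfolding tapes_ok_def by simp
    then show ?thesis using length_holds A3(2)[OF us] by (fastforce simp: q_def)
  qed
  define D where "D x = (\<lambda>ts. (take (tapes F) ts, drop (tapes F) ts, [] :: tape list)) ` A4 x" for x
  have DA: "{pre @ ts @ post | pre ts post. (pre, ts, post) \<in> D x} = A4 x" for x
  proof (intro equalityI subsetI)
    fix us
    assume "us \<in> A4 x"
    then have "(take (tapes F) us, drop (tapes F) us, []) \<in> D x" unfolding D_def by blast
    moreover have "us = take (tapes F) us @ drop (tapes F) us @ []" by simp
    ultimately show "us \<in> {pre @ ts @ post | pre ts post. (pre, ts, post) \<in> D x}" by blast
  qed (auto simp: D_def)
  define A5 where "A5 x = {pre @ ts' @ post | pre ts ts' post. (pre, ts, post) \<in> D x \<and> ts' \<in> results N ts}" for x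
  have "runs (tapes F + tapes N + 0) \<Gamma> (\<lambda>x. {pre @ ts @ post | pre ts post. (pre, ts, post) \<in> D x}) A5"
    unfolding A5_def
  \<comment> \<open>\<open>N\<close> runs on the copied word and not on \<open>x\<close>. The length
    of that word is at most \<open>q\<close> at the length of \<open>x\<close>, hence the
    composition of the time bound with \<open>q\<close>.\<close>
  proof (rule runs_lift[OF N(1) \<Gamma>(4,1), where p = "pcompose pN q"])
    show "admissible (tapes F + tapes N + 0) \<Gamma> (\<lambda>x. {pre @ ts @ post | pre ts post. (pre, ts, post) \<in> D x})"
      unfolding DA using admissible_runs[OF run4] by (simp add: k_def)
    fix x pre ts post
    assume "(pre, ts, post) \<in> D x"
    then obtain us where us: "us \<in> A4 x" "pre = take (tapes F) us" "ts = drop (tapes F) us" "post = []"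
      unfolding D_def by blast
    have "length us = k" using A4[OF us(1)] by blast
    then show "length pre = tapes F \<and> length ts = tapes N \<and> length post = 0"
      using us(2-4) by (simp add: k_def)
    have "ts = initial (tapes N) (the (V x))" using A4[OF us(1)] us(3) by simp
    then show "halts_within N ts (poly (pcompose pN q) (length x))"
      using halts_within_mono[OF pN poly_nat_mono[OF long[OF us(1)]]] by (simp add: poly_pcompose)
  qed
  then have run5: "runs k \<Gamma> A4 A5" unfolding DA k_def by simp
  have "A5 x \<noteq> {} \<longleftrightarrow> (\<exists>y. V x = Some y \<and> y \<in> B)" for x
  proof -
    have "A5 x \<noteq> {} \<longleftrightarrow> (\<exists>us \<in> A4 x. results N (drop (tapes F) us) \<noteq> {})"
      unfolding A5_def D_def by blast
    also have "\<dots> \<longleftrightarrow> A4 x \<noteq> {} \<and> the (V x) \<in> B"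
      using A4[of _ x] unfolding N(3) by auto
    also have "\<dots> \<longleftrightarrow> (\<exists>y. V x = Some y \<and> y \<in> B)"
      unfolding A4_def image_is_empty A3(1) by auto
    finally show ?thesis .
  qed
  moreover have "(\<exists>y. V x = Some y \<and> y \<in> B) \<longleftrightarrow>
      (\<exists>a b y. f x = a # b # y \<and> a \<in> S \<and> b \<in> T \<and> y \<in> B)" for x
    by (auto simp: V_def strip_def split: list.splits if_splits)
  ultimately have "{x. A5 x \<noteq> {}} = {x. \<exists>a b y. f x = a # b # y \<and> a \<in> S \<and> b \<in> T \<and> y \<in> B}"
    by auto
  then show ?thesis
    using NP_I[OF runs_seq[OF run1 runs_seq[OF run2 runs_seq[OF run3 runs_seq[OF run4 run5]]]]] by simp
qed

lemma R_SN_1tt_NP_subset_DP: "R_SN_1tt NP \<subseteq> DP"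
proof
  fix L
  assume "L \<in> R_SN_1tt NP"
  then obtain B f where B: "B \<in> NP" and f: "f \<in> NPSV_t"
    and red: "\<And>x. \<exists>y \<alpha>. f x = encode_query y \<alpha> \<and> (x \<in> L \<longleftrightarrow> \<alpha> (y \<in> B))"
    unfolding R_SN_1tt_def SN_1tt_reducible_def by blast
  \<comment> \<open>The machine for \<open>f\<close> accepts every input, so it is itself a
    witness.\<close>
  have UNIV: "UNIV \<in> NP"
    using f unfolding NPSV_t_def NP_def by auto
  define pre where "pre S T C = {x. \<exists>a b y. f x = a # b # y \<and> a \<in> S \<and> b \<in> T \<and> y \<in> C}" for S T C
  \<comment> \<open>\<open>UNIV\<close> in a position drops the condition on that bit or on
    \<open>y\<close>.\<close>
  let ?L1 = "pre {True} UNIV UNIV \<union> pre UNIV {True} B"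
  let ?L2 = "pre UNIV {False} B"
  have "pre S T C \<in> NP" if "C \<in> NP" for S T C
    unfolding pre_def using NP_prefix[OF f that] .
  then have "?L1 \<in> NP" "?L2 \<in> NP"
    using B UNIV by (simp_all add: NP_Un)
  moreover have "x \<in> L \<longleftrightarrow> x \<in> ?L1 - ?L2" for x
  proof -
    obtain y \<alpha> where f: "f x = \<alpha> False # \<alpha> True # y" and x: "x \<in> L \<longleftrightarrow> \<alpha> (y \<in> B)"
      using red[of x] unfolding encode_query_def by blast
    show ?thesis unfolding pre_def x by (cases "y \<in> B") (auto simp: f)
  qed
  ultimately show "L \<in> DP" unfolding DP_def by blast
qed


section \<open>Machines that halt\<close>

text \<open>Otherwise every configuration reached could be continued, and there would be a run of
  length \<open>Suc N\<close>.\<close>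

lemma exists_halting_config:
  assumes "halts_within M ts N"
  obtains c where "((start M, ts), c) \<in> (step M)\<^sup>*" "c \<notin> Domain (step M)"
proof -
  have "\<exists>c. ((start M, ts), c) \<in> (step M)\<^sup>* \<and> c \<notin> Domain (step M)"
  proof (rule ccontr)
    assume *: "\<not> ?thesis"
    have "\<exists>c. ((start M, ts), c) \<in> step M ^^ n" for n
    proof (induction n)
      case (Suc n)
      then obtain c where c: "((start M, ts), c) \<in> step M ^^ n" by blast
      then have "c \<in> Domain (step M)" using * relpow_imp_rtrancl by blast
      then obtain d where "(c, d) \<in> step M" by blast
      with c have "((start M, ts), d) \<in> step M ^^ Suc n" by (rule relpow_Suc_I)
      then show ?case ..
    qed auto
    then obtain c where "((start M, ts), c) \<in> step M ^^ Suc N" by blast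
    then have "Suc N \<le> N" using assms unfolding halts_within_def by blast
    then show False by simp
  qed
  then show thesis using that by blast
qed

text \<open>A single-valued relation is confluent, and configurations without successor can be
  joined only if they are equal.\<close>

lemma halting_config_unique:
  assumes "single_valued r" "(a, b) \<in> r\<^sup>*" "(a, c) \<in> r\<^sup>*" "b \<notin> Domain r" "c \<notin> Domain r"
  shows "b = c"
  using single_valued_confluent[OF assms(1-3)] assms(4,5)
  by (auto elim: converse_rtranclE)

lemma accepting_halts:
  assumes "wf_tm M" "q \<in> accepting M"
  shows "(q, ts) \<notin> Domain (step M)"
  using wf_stepD(2)[OF assms(1)] assms(2) by fastforce

text \<open>Makes halting in a state of \<open>S\<close> count as acceptance, whatever was accepting
  before. Halting depends on the scanned symbols and not only on the state, so the new entries fill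
  precisely the gaps of the table. Applied to an oracle machine, this also ends a run at its first
  query, as the query state has no transitions.\<close>

definition finish_tm :: "nat set \<Rightarrow> 'a tm_scheme \<Rightarrow> tm" where
  "finish_tm S M = (let s = Suc (Max (states M)) in
     \<lparr>tapes = tapes M, states = insert s (states M), alphabet = alphabet M, start = start M,
      accepting = {s},
      trans = trans M \<union> {(q, rs, s, keep rs) | q rs. q \<in> S \<and> length rs = tapes M \<and>
        set rs \<subseteq> alphabet M \<and> (\<nexists>q' ws. (q, rs, q', ws) \<in> trans M)}\<rparr>)"

lemma finish_tm_simps [simp]:
  "tapes (finish_tm S M) = tapes M" "alphabet (finish_tm S M) = alphabet M"
  "start (finish_tm S M) = start M" "accepting (finish_tm S M) = {Suc (Max (states M))}"
  by (simp_all add: finish_tm_def Let_def)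

lemma Suc_Max_states:
  assumes "wf_tm M"
  shows "Suc (Max (states M)) \<notin> states M"
proof
  assume "Suc (Max (states M)) \<in> states M"
  moreover have "finite (states M)" using assms by (simp add: wf_tm_def)
  ultimately have "Suc (Max (states M)) \<le> Max (states M)" by (rule Max_ge[rotated])
  then show False by simp
qed

lemma wf_finish_tm:
  assumes wf: "wf_tm M" and S: "S \<subseteq> states M"
  shows "wf_tm (finish_tm S M)"
proof (rule wf_tmI)
  fix q rs q' ws
  let ?M = "finish_tm S M"
  note fresh = Suc_Max_states[OF wf]
  assume "(q, rs, q', ws) \<in> trans ?M"
  then consider "(q, rs, q', ws) \<in> trans M"
    | "q \<in> S" "q' = Suc (Max (states M))" "ws = keep rs" "length rs = tapes M" "set rs \<subseteq> alphabet M"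
    by (auto simp: finish_tm_def Let_def)
  then show "q \<in> states ?M - accepting ?M \<and> q' \<in> states ?M \<and> length rs = tapes ?M \<and>
      set rs \<subseteq> alphabet ?M \<and> length ws = tapes ?M \<and> fst ` set ws \<subseteq> alphabet ?M"
  proof cases
    case 1
    then show ?thesis using wf_transD[OF wf 1] fresh by (auto simp: finish_tm_def Let_def)
  next
    case 2
    then show ?thesis using S fresh by (auto simp: finish_tm_def Let_def)
  qed
qed (use wf in \<open>auto simp: wf_tm_def finish_tm_def Let_def\<close>)

lemma step_finish_tm:
  "((q, ts), c) \<in> step (finish_tm S M) \<longleftrightarrow> ((q, ts), c) \<in> step M \<or>
     q \<in> S \<and> length ts = tapes M \<and> scan ` set ts \<subseteq> alphabet M \<and> (q, ts) \<notin> Domain (step M) \<and>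
     c = (Suc (Max (states M)), ts)"
proof -
  have "(q, ts) \<in> Domain (step M) \<longleftrightarrow> (\<exists>q' ws. (q, map scan ts, q', ws) \<in> trans M)"
    unfolding Domain_iff step_eq_steps steps_iff by blast
  then show ?thesis
    unfolding step_eq_steps steps_iff by (auto simp: finish_tm_def Let_def)
qed

lemma relpow_finish_tm:
  assumes wf: "wf_tm M" and S: "S \<subseteq> states M"
    and n: "((start M, ts), c) \<in> step (finish_tm S M) ^^ n"
  shows "((start M, ts), c) \<in> step M ^^ n \<or>
    (\<exists>m q ts'. n = Suc m \<and> ((start M, ts), (q, ts')) \<in> step M ^^ m \<and> q \<in> S \<and>
       (q, ts') \<notin> Domain (step M) \<and> c = (Suc (Max (states M)), ts'))"
  using n
proof (induction n arbitrary: c)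
  case (Suc n)
  then obtain q us where d: "((start M, ts), (q, us)) \<in> step (finish_tm S M) ^^ n"
    "((q, us), c) \<in> step (finish_tm S M)" by auto
  have q: "q \<in> states M" using d(2) wf_stepD(1)[OF wf] S unfolding step_finish_tm by fastforce
  then have "((start M, ts), (q, us)) \<in> step M ^^ n"
    using Suc.IH[OF d(1)] Suc_Max_states[OF wf] by auto
  then show ?case using d(2) unfolding step_finish_tm by auto
qed auto

lemma halts_within_finish_tm:
  assumes "wf_tm M" "S \<subseteq> states M" "halts_within M ts N"
  shows "halts_within (finish_tm S M) ts (Suc N)"
  unfolding halts_within_def finish_tm_simps
proof (intro allI impI)
  fix n c
  have h: "m \<le> N" if "((start M, ts), d) \<in> step M ^^ m" for m d
    using assms(3) that unfolding halts_within_def by blast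
  assume "((start M, ts), c) \<in> step (finish_tm S M) ^^ n"
  from relpow_finish_tm[OF assms(1,2) this] show "n \<le> Suc N"
    by (auto dest: h)
qed

lemma poly_time_finish_tm:
  assumes "wf_tm M" "S \<subseteq> states M" "poly_time M"
  shows "poly_time (finish_tm S M)"
proof -
  obtain p where p: "\<And>x. halts_within M (initial (tapes M) x) (poly p (length x))"
    using assms(3) unfolding poly_time_iff by blast
  show ?thesis
    unfolding poly_time_iff using halts_within_finish_tm[OF assms(1,2) p]
    by (intro exI[of _ "1 + p"]) simp
qed

lemma results_finish_tm:
  assumes wf: "wf_tm M" and S: "S \<subseteq> states M" and ok: "tapes_ok (tapes M) (alphabet M) n ts"
  shows "results (finish_tm S M) ts =
    {ts'. \<exists>q \<in> S. ((start M, ts), (q, ts')) \<in> (step M)\<^sup>* \<and> (q, ts') \<notin> Domain (step M)}"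
proof (intro equalityI subsetI)
  let ?s = "Suc (Max (states M))"
  fix ts'
  assume "ts' \<in> results (finish_tm S M) ts"
  then obtain n where n: "((start M, ts), (?s, ts')) \<in> step (finish_tm S M) ^^ n"
    unfolding results_def rtrancl_power by auto
  have "((start M, ts), (?s, ts')) \<notin> step M ^^ n"
    using wf_relpow_states[OF wf] Suc_Max_states[OF wf] by fastforce
  with relpow_finish_tm[OF wf S n]
  show "ts' \<in> {ts'. \<exists>q \<in> S. ((start M, ts), (q, ts')) \<in> (step M)\<^sup>* \<and> (q, ts') \<notin> Domain (step M)}"
    by (auto dest: relpow_imp_rtrancl)
next
  let ?s = "Suc (Max (states M))"
  fix ts'
  assume "ts' \<in> {ts'. \<exists>q \<in> S. ((start M, ts), (q, ts')) \<in> (step M)\<^sup>* \<and> (q, ts') \<notin> Domain (step M)}"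
  then obtain q where q: "q \<in> S" "((start M, ts), (q, ts')) \<in> (step M)\<^sup>*" "(q, ts') \<notin> Domain (step M)"
    by blast
  obtain m where "tapes_ok (tapes M) (alphabet M) m ts'"
    using tapes_ok_rtrancl[OF wf q(2)] ok by auto
  then have "((q, ts'), (?s, ts')) \<in> step (finish_tm S M)"
    unfolding step_finish_tm using q tapes_ok_length tapes_ok_scan by blast
  moreover have "step M \<subseteq> step (finish_tm S M)"
    unfolding step_eq_steps by (auto simp: finish_tm_def Let_def steps_Un)
  then have "(step M)\<^sup>* \<subseteq> (step (finish_tm S M))\<^sup>*" by (rule rtrancl_mono)
  ultimately have "((start M, ts), (?s, ts')) \<in> (step (finish_tm S M))\<^sup>*"
    using q(2) by (meson rtrancl.rtrancl_into_rtrancl subsetD)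
  then show "ts' \<in> results (finish_tm S M) ts" unfolding results_def by simp
qed

lemma single_valued_step: "deterministic M \<Longrightarrow> single_valued (step M)"
  unfolding deterministic_def single_valued_def step_def by blast

text \<open>For \<open>b = False\<close> this decides the complement, provided that \<open>M\<close>
  is deterministic and always halts.\<close>

definition verdict_tm :: "bool \<Rightarrow> tm \<Rightarrow> tm" where
  "verdict_tm b M = finish_tm {q \<in> states M. (q \<in> accepting M) = b} M"

text \<open>There is exactly one halting configuration; its state determines both acceptance by
  \<open>M\<close> and membership in the set given to \<open>finish_tm\<close>.\<close>

lemma results_verdict_tm:
  assumes wf: "wf_tm M" and poly: "poly_time M" and det: "single_valued (step M)"
  shows "results (verdict_tm b M) (initial (tapes M) x) \<noteq> {} \<longleftrightarrow> (accepting_configs M x \<noteq> {}) = b"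
proof -
  let ?I = "initial (tapes M) x" and ?S = "{q \<in> states M. (q \<in> accepting M) = b}"
  obtain N where "halts_within M ?I N" using poly unfolding poly_time_iff by blast
  then obtain q ts where c: "((start M, ?I), (q, ts)) \<in> (step M)\<^sup>*" "(q, ts) \<notin> Domain (step M)"
    using exists_halting_config by (metis surj_pair)
  have unique: "r = q \<and> us = ts"
    if "((start M, ?I), (r, us)) \<in> (step M)\<^sup>*" "(r, us) \<notin> Domain (step M)" for r us
    using halting_config_unique[OF det c(1) that(1) c(2) that(2)] by simp
  obtain n where "((start M, ?I), (q, ts)) \<in> step M ^^ n" using c(1) unfolding rtrancl_power by blast
  then have q: "q \<in> states M" using wf_relpow_states[OF wf] by fastforce
  have acc: "accepting_configs M x \<noteq> {} \<longleftrightarrow> q \<in> accepting M"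
  proof
    assume "accepting_configs M x \<noteq> {}"
    then obtain r us where r: "((start M, ?I), (r, us)) \<in> (step M)\<^sup>*" "r \<in> accepting M"
      unfolding accepting_configs_def init_eq by auto
    then show "q \<in> accepting M" using unique[OF r(1) accepting_halts[OF wf r(2)]] by simp
  next
    assume "q \<in> accepting M"
    then show "accepting_configs M x \<noteq> {}"
      using c(1) unfolding accepting_configs_def init_eq by auto
  qed
  have ok: "tapes_ok (tapes M) (alphabet M) (length x) ?I"
    using tapes_ok_initial wf_tm_basics[OF wf] by blast
  have S: "?S \<subseteq> states M" by blast
  have "results (verdict_tm b M) ?I \<noteq> {} \<longleftrightarrow> q \<in> ?S"
    unfolding verdict_tm_def results_finish_tm[OF wf S ok] using c unique by blast
  then show ?thesis using acc q by simp
qed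


section \<open>Oracle machines with fixed answers\<close>

definition answer_tm :: "bool \<Rightarrow> oracle_tm \<Rightarrow> tm" where
  "answer_tm a M = \<lparr>tapes = tapes M, states = states M, alphabet = alphabet M, start = start M,
     accepting = accepting M,
     trans = trans M \<union> jumps {query_state M} (alphabet M) (tapes M)
       (if a then yes_state M else no_state M)\<rparr>"

lemma answer_tm_simps [simp]:
  "tapes (answer_tm a M) = tapes M" "alphabet (answer_tm a M) = alphabet M"
  "start (answer_tm a M) = start M" "accepting (answer_tm a M) = accepting M"
  "states (answer_tm a M) = states M" "init (answer_tm a M) x = init M x"
  by (simp_all add: answer_tm_def init_def)

text \<open>Giving the same answer to all queries is itself an oracle, so what is assumed for all
  oracles applies to \<open>answer_tm\<close>.\<close>

definition constant_oracle :: "bool \<Rightarrow> language" where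
  "constant_oracle a = (if a then UNIV else {})"

lemma wf_answer_tm:
  assumes "wf_oracle_tm M"
  shows "wf_tm (answer_tm a M)"
proof (rule wf_tmI)
  have wf: "wf_tm M" and Q: "query_state M \<in> states M" "yes_state M \<in> states M" "no_state M \<in> states M"
    "query_state M \<notin> accepting M"
    using assms by (auto simp: wf_oracle_tm_def)
  fix q rs q' ws
  assume "(q, rs, q', ws) \<in> trans (answer_tm a M)"
  then consider "(q, rs, q', ws) \<in> trans M"
    | "q = query_state M" "q' \<in> {yes_state M, no_state M}" "ws = keep rs" "length rs = tapes M"
      "set rs \<subseteq> alphabet M"
    by (auto simp: answer_tm_def jumps_def)
  then show "q \<in> states (answer_tm a M) - accepting (answer_tm a M) \<and> q' \<in> states (answer_tm a M) \<and>
      length rs = tapes (answer_tm a M) \<and> set rs \<subseteq> alphabet (answer_tm a M) \<and>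
      length ws = tapes (answer_tm a M) \<and> fst ` set ws \<subseteq> alphabet (answer_tm a M)"
  proof cases
    case 1
    then show ?thesis using wf_transD[OF wf 1] by simp
  next
    case 2
    then show ?thesis using Q by auto
  qed
qed (use assms in \<open>auto simp: wf_tm_def wf_oracle_tm_def\<close>)

lemma oracle_step_iff:
  "((q, ts), c) \<in> oracle_step M B \<longleftrightarrow> ((q, ts), c) \<in> step M \<or>
     q = query_state M \<and> c = (if tape_word (last ts) \<in> B then yes_state M else no_state M, ts)"
  unfolding oracle_step_def by auto

lemma step_answer_tm:
  "((q, ts), c) \<in> step (answer_tm a M) \<longleftrightarrow> ((q, ts), c) \<in> step M \<or>
     q = query_state M \<and> length ts = tapes M \<and> scan ` set ts \<subseteq> alphabet M \<and>
     c = (if a then yes_state M else no_state M, ts)"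
  unfolding step_eq_steps by (auto simp: answer_tm_def steps_Un steps_jumps)

lemma step_answer_tm_subset: "step (answer_tm a M) \<subseteq> oracle_step M (constant_oracle a)"
proof
  fix c
  assume "c \<in> step (answer_tm a M)"
  moreover obtain q ts d where "c = ((q, ts), d)" by (metis surj_pair)
  ultimately show "c \<in> oracle_step M (constant_oracle a)"
    by (auto simp: step_answer_tm oracle_step_iff constant_oracle_def)
qed

text \<open>The two relations differ only on tape lists of the wrong length or with symbols outside
  the alphabet, where \<open>answer_tm\<close> has no jump; such tape lists are never
  reached.\<close>

lemma relpow_answer_tm:
  assumes wf: "wf_oracle_tm M"
  shows "(init M x, c) \<in> step (answer_tm a M) ^^ n \<longleftrightarrow>
    (init M x, c) \<in> oracle_step M (constant_oracle a) ^^ n"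
proof (induction n arbitrary: c)
  case (Suc n)
  have "(d, c) \<in> step (answer_tm a M) \<longleftrightarrow> (d, c) \<in> oracle_step M (constant_oracle a)"
    if d: "(init M x, d) \<in> step (answer_tm a M) ^^ n" for d
  proof -
    have wf': "wf_tm (answer_tm a M)" using wf_answer_tm[OF wf] .
    have "tapes_ok (tapes M) (alphabet M) (length x) (snd (init M x))"
      unfolding init_eq snd_conv using tapes_ok_initial wf_tm_basics[OF wf'] by simp
    then have "tapes_ok (tapes M) (alphabet M) (length x + n) (snd d)"
      using tapes_ok_relpow[OF wf' d, of "length x"] by simp
    from tapes_ok_length[OF this] tapes_ok_scan[OF this] show ?thesis
      by (cases d) (simp add: step_answer_tm oracle_step_iff constant_oracle_def)
  qed
  then show ?case using Suc.IH unfolding relpow.simps relcomp_unfold by blast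
qed simp

lemma poly_time_answer_tm:
  assumes "wf_oracle_tm M" "oracle_poly_time M"
  shows "poly_time (answer_tm a M)"
  using assms(2) unfolding poly_time_def oracle_poly_time_def answer_tm_simps
    relpow_answer_tm[OF assms(1)] by blast

text \<open>An oracle answer never competes with an ordinary transition, since the query state has
  none.\<close>

lemma single_valued_oracle_step:
  assumes "wf_oracle_tm M" "deterministic M"
  shows "single_valued (oracle_step M B)"
proof (rule single_valuedI)
  fix c d e
  assume *: "(c, d) \<in> oracle_step M B" "(c, e) \<in> oracle_step M B"
  obtain q ts where c: "c = (q, ts)" by fastforce
  have "((query_state M, ts), u) \<notin> step M" for u
    using assms(1) unfolding wf_oracle_tm_def step_eq_steps steps_iff by force
  then show "d = e"
    using * single_valuedD[OF single_valued_step[OF assms(2)]] unfolding c oracle_step_iff by metis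
qed

lemma relpow_subset_mono: "r \<subseteq> s \<Longrightarrow> r ^^ n \<subseteq> s ^^ n" for r s :: "('a \<times> 'a) set"
  by (induction n) (auto intro: relcomp_mono)

text \<open>
  Up to its only query, the computation uses \<open>step M\<close> alone; so the query word can be
  computed without the oracle, and afterwards the answer to it is all that matters.
\<close>

lemma oracle_accepts_iff:
  assumes wf: "wf_oracle_tm M" and det: "deterministic M"
    and one: "finite (query_times M B x)" "card (query_times M B x) \<le> 1"
    and c: "(init M x, (q, ts)) \<in> (step M)\<^sup>*" "(q, ts) \<notin> Domain (step M)"
    and a: "a \<longleftrightarrow> tape_word (last ts) \<in> B"
  shows "oracle_accepts M B x \<longleftrightarrow> accepting_configs (answer_tm a M) x \<noteq> {}"
proof -
  have halt: "((query_state M, us), d) \<notin> step M" for us d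
    using wf unfolding wf_oracle_tm_def step_eq_steps steps_iff by force
  have no_query: "(init M x, d) \<in> step M ^^ n"
    if "(init M x, d) \<in> oracle_step M B ^^ n" "\<forall>m<n. m \<notin> query_times M B x" for n d
    using that
  proof (induction n arbitrary: d)
    case (Suc n)
    then obtain r us where e: "(init M x, (r, us)) \<in> oracle_step M B ^^ n" "((r, us), d) \<in> oracle_step M B"
      by auto
    have "r \<noteq> query_state M" using e(1) Suc.prems(2) unfolding query_times_def by auto
    then have "((r, us), d) \<in> step M" using e(2) unfolding oracle_step_iff by blast
    then show ?case using Suc.IH[OF e(1)] Suc.prems(2) by auto
  qed simp
  \<comment> \<open>A query configuration is reached by \<open>step M\<close> alone and has no
    successor there. So it is the halting configuration of \<open>M\<close> without oracle, and its
    query word is the one that defines \<open>a\<close>.\<close>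
  have query: "r = q \<and> us = ts"
    if r: "r = query_state M" "(init M x, (r, us)) \<in> oracle_step M B ^^ n" for r us n
  proof -
    have n: "n \<in> query_times M B x" using r unfolding query_times_def by blast
    \<comment> \<open>As there is at most one query time, the query at time \<open>n\<close> is the
      first one.\<close>
    have "\<forall>m<n. m \<notin> query_times M B x"
      using one n card_le_Suc0_iff_eq[OF one(1)] by auto
    then have "(init M x, (r, us)) \<in> (step M)\<^sup>*"
      using no_query[OF r(2)] relpow_imp_rtrancl by blast
    moreover have "(r, us) \<notin> Domain (step M)" using halt r(1) by blast
    ultimately show ?thesis
      using halting_config_unique[OF single_valued_step[OF det] c(1) _ c(2)] by blast
  qed
  have "(init M x, d) \<in> oracle_step M B ^^ n \<longleftrightarrow>
      (init M x, d) \<in> oracle_step M (constant_oracle a) ^^ n" for n d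
  proof (induction n arbitrary: d)
    case (Suc n)
    \<comment> \<open>The relations could differ only at a query, and any query reached is the one
      whose answer is \<open>a\<close>. Elsewhere both use \<open>step M\<close>.\<close>
    have "(e, d) \<in> oracle_step M B \<longleftrightarrow> (e, d) \<in> oracle_step M (constant_oracle a)"
      if "(init M x, e) \<in> oracle_step M B ^^ n" for e
    proof -
      obtain r us where e: "e = (r, us)" by fastforce
      show ?thesis
        using query[of r us n] that a unfolding e oracle_step_iff constant_oracle_def by auto
    qed
    then show ?case using Suc.IH unfolding relpow.simps relcomp_unfold by blast
  qed simp
  then show ?thesis
    unfolding oracle_accepts_def accepting_configs_def rtrancl_power answer_tm_simps
      relpow_answer_tm[OF wf] by blast
qed


section \<open>The query function\<close>

lemma runs_prepend:
  assumes adm: "admissible k \<Gamma> A" and k: "i < k" "finite \<Gamma>" "{Blank, Bit False, Bit True} \<subseteq> \<Gamma>"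
  shows "runs k \<Gamma> A (\<lambda>x. (\<lambda>ts. ts[i := prepend b (ts ! i)]) ` A x)"
proof -
  let ?left = "\<lambda>ts. ts[i := act (scan (ts ! i), MoveL) (ts ! i)]"
  have "runs k \<Gamma> A (\<lambda>x. {ts[i := act a (ts ! i)] | ts a. ts \<in> A x \<and> Some (scan (ts ! i), MoveL) = Some a})"
    by (rule runs_act[OF adm k]) auto
  moreover have "{ts[i := act a (ts ! i)] | ts a. ts \<in> A x \<and> Some (scan (ts ! i), MoveL) = Some a} =
      ?left ` A x" for x by auto
  ultimately have 1: "runs k \<Gamma> A (\<lambda>x. ?left ` A x)" by simp
  have "runs k \<Gamma> (\<lambda>x. ?left ` A x)
      (\<lambda>x. {ts[i := act a (ts ! i)] | ts a. ts \<in> ?left ` A x \<and> Some (Bit b, Stay) = Some a})"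
    using k(3) by (intro runs_act[OF admissible_runs[OF 1] k]) (cases b; auto)
  moreover have "{ts[i := act a (ts ! i)] | ts a. ts \<in> ?left ` A x \<and> Some (Bit b, Stay) = Some a} =
      (\<lambda>ts. ts[i := act (Bit b, Stay) (ts ! i)]) ` ?left ` A x" for x by auto
  moreover have "(\<lambda>ts. ts[i := act (Bit b, Stay) (ts ! i)]) ` ?left ` A x =
      (\<lambda>ts. ts[i := prepend b (ts ! i)]) ` A x" for x
    unfolding image_image
  proof (rule image_cong[OF refl])
    fix ts
    assume "ts \<in> A x"
    then have "length ts = k" using adm tapes_ok_length unfolding admissible_def by blast
    then show "(?left ts)[i := act (Bit b, Stay) (?left ts ! i)] = ts[i := prepend b (ts ! i)]"
      using k(1) by (simp add: prepend_def)
  qed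
  ultimately have 2: "runs k \<Gamma> (\<lambda>x. ?left ` A x) (\<lambda>x. (\<lambda>ts. ts[i := prepend b (ts ! i)]) ` A x)"
    by simp
  show ?thesis using runs_seq[OF 1 2] .
qed

lemma nth_initial: "j < k \<Longrightarrow> initial k x ! j = (if j = 0 then input_tape x else blank_tape)"
  by (simp add: initial_def nth_Cons')

lemma nth_copy_word:
  assumes "j < length ts"
  shows "copy_word i J ts ! j =
    (if j = i then (fst (ts ! i), snd (ts ! i) + int (length (tape_word (ts ! i))))
     else if j \<in> J then input_tape (tape_word (ts ! i)) else ts ! j)"
  using assms by (simp add: copy_word_def Let_def)

text \<open>Machines spoil their tapes, so each of three gets its own copy of \<open>x\<close>. The
  index set lists the first tapes of three blocks of \<open>k\<close> tapes behind the source
  tape.\<close>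

lemma copy_word_initial:
  assumes "1 \<le> k"
  shows "copy_word 0 {1, 1 + k, 1 + 2 * k} (initial (1 + 3 * k) x) =
    [(fst (input_tape x), int (length x))] @ initial k x @ initial k x @ initial k x"
proof -
  have w: "tape_word (initial (1 + 3 * k) x ! 0) = x"
    by (simp add: initial_def) (rule tape_word_eq, auto simp: holds_def input_tape_def)
  have len: "length (initial l x) = l" if "1 \<le> l" for l
    using that by (simp add: initial_def)
  show ?thesis
  proof (rule nth_equalityI)
    show "length (copy_word 0 {1, 1 + k, 1 + 2 * k} (initial (1 + 3 * k) x)) =
        length ([(fst (input_tape x), int (length x))] @ initial k x @ initial k x @ initial k x)"
      using assms len by (simp add: copy_word_def Let_def)
    fix j
    assume "j < length (copy_word 0 {1, 1 + k, 1 + 2 * k} (initial (1 + 3 * k) x))"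
    then have j: "j < 1 + 3 * k" using len by (simp add: copy_word_def Let_def)
    have "copy_word 0 {1, 1 + k, 1 + 2 * k} (initial (1 + 3 * k) x) ! j =
        (if j = 0 then (fst (input_tape x), int (length x))
         else if j \<in> {1, 1 + k, 1 + 2 * k} then input_tape x else blank_tape)"
    proof -
      have "j < length (initial (1 + 3 * k) x)" using j len by simp
      then show ?thesis
        unfolding nth_copy_word[OF \<open>j < length (initial (1 + 3 * k) x)\<close>] w nth_initial[OF j]
        by (simp add: nth_initial)
    qed
    moreover have "([(fst (input_tape x), int (length x))] @ initial k x @ initial k x @ initial k x) ! j =
        (if j = 0 then (fst (input_tape x), int (length x))
         else if j \<in> {1, 1 + k, 1 + 2 * k} then input_tape x else blank_tape)"
      using j assms len[OF assms] by (auto simp: nth_append nth_Cons' nth_initial)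
    ultimately show "copy_word 0 {1, 1 + k, 1 + 2 * k} (initial (1 + 3 * k) x) ! j =
        ([(fst (input_tape x), int (length x))] @ initial k x @ initial k x @ initial k x) ! j" by simp
  qed
qed

text \<open>
  The two decisions are guessed and verified (a union over the four cases), so that no machine
  has to branch on the outcome of another one.
\<close>

lemma NPSV_t_decisions:
  fixes D0 D1 :: "bool \<Rightarrow> tm" and N :: tm
  assumes wf: "\<And>b. wf_tm (D0 b)" "\<And>b. wf_tm (D1 b)" "wf_tm N"
    and tapes: "\<And>b. tapes (D0 b) = k" "\<And>b. tapes (D1 b) = k" "tapes N = k"
    and alphabet: "\<And>b. alphabet (D0 b) = \<Gamma>" "\<And>b. alphabet (D1 b) = \<Gamma>" "alphabet N = \<Gamma>"
    and poly: "\<And>b. poly_time (D0 b)" "\<And>b. poly_time (D1 b)" "poly_time N"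
    and D0: "\<And>b x. results (D0 b) (initial k x) \<noteq> {} \<longleftrightarrow> P0 x = b"
    and D1: "\<And>b x. results (D1 b) (initial k x) \<noteq> {} \<longleftrightarrow> P1 x = b"
    and N: "\<And>x. results N (initial k x) \<noteq> {}"
      "\<And>x ts. ts \<in> results N (initial k x) \<Longrightarrow> tape_word (last ts) = g x"
  shows "(\<lambda>x. P0 x # P1 x # g x) \<in> NPSV_t"
proof -
  have k: "1 \<le> k" and \<Gamma>: "finite \<Gamma>" "{Blank, Bit False, Bit True} \<subseteq> \<Gamma>"
    using wf_tm_basics[OF wf(3)] tapes(3) alphabet(3) by simp_all
  \<comment> \<open>One source tape and three blocks. The block of \<open>N\<close> comes last, so
    that its output tape is the last tape overall, with index \<open>3 * k\<close>.\<close>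
  define K where "K = 1 + 3 * k"
  define src where "src x = (fst (input_tape x), int (length x))" for x
  let ?I = "initial k"
  have run0: "runs K \<Gamma> (\<lambda>x. {initial K x}) (\<lambda>x. {[src x] @ ?I x @ ?I x @ ?I x})"
  proof -
    have "runs K \<Gamma> (\<lambda>x. {initial K x}) (\<lambda>x. copy_word 0 {1, 1 + k, 1 + 2 * k} ` {initial K x})"
    proof (rule runs_copy_word[where ?j0.0 = 1])
      show "admissible K \<Gamma> (\<lambda>x. {initial K x})"
        using admissible_initial[OF \<Gamma>(2)] by (simp add: K_def)
      show "ts ! j = blank_tape" if "ts \<in> {initial K x}" "j \<in> {1, 1 + k, 1 + 2 * k}" "j < K" for x ts j
        using that nth_initial[OF that(3), of x] by auto
    qed (use k \<Gamma> in \<open>auto simp: K_def\<close>)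
    then show ?thesis unfolding K_def src_def by (simp only: image_insert image_empty copy_word_initial[OF k])
  qed
  define A1 where "A1 b x = conc {[src x]} (results (D0 b) (?I x))" for b x
  define A2 where "A2 b c x = conc (A1 b x) (results (D1 c) (?I x))" for b c x
  define A3 where "A3 b c x = conc (A2 b c x) (results N (?I x))" for b c x
  have lenI: "length (?I x) = k" for x using k by (simp add: initial_def)
  have len: "length u = k" if "u \<in> results M (?I x)" "wf_tm M" "tapes M = k" for M :: tm and u x
    using that relpow_length[OF that(2)] lenI unfolding results_def rtrancl_power by blast
  have len1: "length p = 1 + k" if "p \<in> A1 b x" for p b x
    using that len[OF _ wf(1) tapes(1)] unfolding A1_def conc_def by auto
  have len2: "length p = 1 + 2 * k" if "p \<in> A2 b c x" for p b c x
    using that len1 len[OF _ wf(2) tapes(2)] unfolding A2_def conc_def by fastforce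
  have run1: "runs K \<Gamma> (\<lambda>x. {[src x] @ ?I x @ ?I x @ ?I x}) (\<lambda>x. {p @ ?I x @ ?I x | p. p \<in> A1 b x})" for b
  proof -
    have A: "{p @ ?I x @ ?I x @ ?I x | p. p \<in> {[src x]}} = {[src x] @ ?I x @ ?I x @ ?I x}" for x
      by simp
    have "runs K \<Gamma> (\<lambda>x. {p @ ?I x @ ?I x @ ?I x | p. p \<in> {[src x]}}) (\<lambda>x. {p @ ?I x @ ?I x | p. p \<in> A1 b x})"
      using runs_block[OF wf(1)[of b] _ \<Gamma>(1) poly(1), of K "\<lambda>x. ?I x @ ?I x" "\<lambda>x. {[src x]}" 1 "2 * k"]
        admissible_runs[OF run0]
      unfolding tapes alphabet A1_def[symmetric] A by (simp add: K_def lenI)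
    then show ?thesis unfolding A .
  qed
  have run2: "runs K \<Gamma> (\<lambda>x. {p @ ?I x @ ?I x | p. p \<in> A1 b x}) (\<lambda>x. {p @ ?I x | p. p \<in> A2 b c x})" for b c
    using runs_block[OF wf(2)[of c] _ \<Gamma>(1) poly(2), of K ?I "A1 b" "1 + k" k]
      admissible_runs[OF run1[of b]] len1
    unfolding tapes alphabet A2_def[symmetric] by (simp add: K_def lenI)
  have run3: "runs K \<Gamma> (\<lambda>x. {p @ ?I x | p. p \<in> A2 b c x}) (A3 b c)" for b c
    using runs_block[OF wf(3) _ \<Gamma>(1) poly(3), of K "\<lambda>x. []" "A2 b c" "1 + 2 * k" 0]
      admissible_runs[OF run2[of b c]] len2
    unfolding tapes alphabet A3_def[symmetric] by (simp add: K_def)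
  define add where "add b ts = ts[3 * k := prepend b (ts ! (3 * k))]" for b ts
  \<comment> \<open>Prepending reverses the order, so the second bit \<open>c\<close> is written
    first. Both bits are guesses written down without inspecting any tape; they are right because
    the machines \<open>D0 b\<close> and \<open>D1 c\<close> have accepted.\<close>
  define A4 where "A4 b c x = add b ` add c ` A3 b c x" for b c x
  have run4: "runs K \<Gamma> (A3 b c) (A4 b c)" for b c
  proof -
    have i: "3 * k < K" by (simp add: K_def)
    have 1: "runs K \<Gamma> (A3 b c) (\<lambda>x. add c ` A3 b c x)"
      unfolding add_def using runs_prepend[OF admissible_runs[OF run3] i \<Gamma>] .
    have 2: "runs K \<Gamma> (\<lambda>x. add c ` A3 b c x) (A4 b c)"
      unfolding A4_def add_def[of b] using runs_prepend[OF admissible_runs[OF 1] i \<Gamma>] .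
    show ?thesis using runs_seq[OF 1 2] .
  qed
  have run: "runs K \<Gamma> (\<lambda>x. {initial K x}) (A4 b c)" for b c
    using runs_seq[OF run0 runs_seq[OF run1 runs_seq[OF run2 runs_seq[OF run3 run4]]]] .
  define A where "A x = (A4 False False x \<union> A4 False True x) \<union> (A4 True False x \<union> A4 True True x)" for x
  have "runs K \<Gamma> (\<lambda>x. {initial K x}) A"
    unfolding A_def by (intro runs_Un run)
  \<comment> \<open>Of the four branches, exactly the one that guesses both bits correctly
    survives.\<close>
  moreover have A4: "A4 b c x \<noteq> {} \<longleftrightarrow> P0 x = b \<and> P1 x = c" for b c x
  proof -
    have "A4 b c x \<noteq> {} \<longleftrightarrow> results (D0 b) (?I x) \<noteq> {} \<and> results (D1 c) (?I x) \<noteq> {} \<and> results N (?I x) \<noteq> {}"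
      unfolding A4_def A3_def A2_def A1_def by (simp add: conc_empty_iff)
    then show ?thesis unfolding D0 D1 using N(1) by blast
  qed
  have "A x \<noteq> {}" for x
    using A4[of "P0 x" "P1 x" x] unfolding A_def by (cases "P0 x"; cases "P1 x") auto
  moreover have "tape_word (last ts) = P0 x # P1 x # g x" if ts: "ts \<in> A x" for x ts
  proof -
    obtain b c where bc: "ts \<in> A4 b c x" using ts unfolding A_def by blast
    then have P: "P0 x = b" "P1 x = c" using A4 by blast+
    obtain us where us: "us \<in> A3 b c x" "ts = add b (add c us)" using bc unfolding A4_def by blast
    obtain p w where w: "us = p @ w" "w \<in> results N (?I x)" and p: "p \<in> A2 b c x"
      using us(1) unfolding A3_def conc_def by blast
    note lens = len2[OF p] len[OF w(2) wf(3) tapes(3)]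
    have "length us = 1 + 3 * k" using w lens by simp
    moreover from this have "us \<noteq> []" by auto
    ultimately have ts_last: "last ts = prepend b (prepend c (us ! (3 * k)))" and us_last: "us ! (3 * k) = last us"
      unfolding us(2) add_def by (simp_all add: last_conv_nth)
    have "last us = last w" using w lens k by (auto simp: last_append)
    then have word: "tape_word (last us) = g x" using N(2)[OF w(2)] by simp
    obtain n where "tapes_ok K \<Gamma> n us"
      using admissible_runs[OF run3] us(1) unfolding admissible_def by blast
    moreover have "us \<noteq> []" using w(1) lens by auto
    ultimately have "holds (last us) (g x)"
      using holds_tape_word[of n "last us"] word unfolding tapes_ok_def by simp
    then have "holds (last ts) (b # c # g x)"
      unfolding ts_last us_last by (intro holds_prepend)
    then show ?thesis using tape_word_eq P by simp
  qed
  ultimately show ?thesis by (rule NPSV_t_I)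
qed

lemma P_one_query_subset_R_SN_1tt: "P_one_query C \<subseteq> R_SN_1tt C"
proof
  fix L
  assume "L \<in> P_one_query C"
  then obtain B M where B: "B \<in> C" and wf: "wf_oracle_tm M" and det: "deterministic M"
    and poly: "oracle_poly_time M"
    and one: "\<And>x. finite (query_times M B x)" "\<And>x. card (query_times M B x) \<le> 1"
    and L: "\<And>x. x \<in> L \<longleftrightarrow> oracle_accepts M B x"
    unfolding P_one_query_def by blast
  define D where "D a = answer_tm a M" for a
  have wfM: "wf_tm M" using wf by (simp add: wf_oracle_tm_def)
  have wfD: "wf_tm (D a)" and polyD: "poly_time (D a)" for a
    unfolding D_def using wf_answer_tm[OF wf] poly_time_answer_tm[OF wf poly] by auto
  have detD: "single_valued (step (D a))" for a
    unfolding D_def using single_valued_subset[OF step_answer_tm_subset] single_valued_oracle_step[OF wf det]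
    by blast
  \<comment> \<open>Without oracle, \<open>M\<close> merely stops at its queries, so its runs are
    among those with any oracle, here the empty one.\<close>
  have polyM: "poly_time M"
  proof -
    have "step M \<subseteq> oracle_step M {}" unfolding oracle_step_def by blast
    then have "step M ^^ n \<subseteq> oracle_step M {} ^^ n" for n by (rule relpow_subset_mono)
    then show ?thesis using poly unfolding poly_time_def oracle_poly_time_def by blast
  qed
  define k where "k = tapes M"
  \<comment> \<open>With all states allowed, every halting configuration accepts: the one at the
    query or, if there is none, the one at the end. This makes the query function total.\<close>
  define N where "N = finish_tm (states M) M"
  have ok: "tapes_ok (tapes M) (alphabet M) (length x) (initial k x)" for x
    using tapes_ok_initial wf_tm_basics[OF wfM] unfolding k_def by blast
  define final where "final x c \<longleftrightarrow> (init M x, c) \<in> (step M)\<^sup>* \<and> c \<notin> Domain (step M)" for x c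
  have final_unique: "c = d" if "final x c" "final x d" for x c d
    using halting_config_unique[OF single_valued_step[OF det]] that unfolding final_def by blast
  have final_ex: "\<exists>q \<in> states M. \<exists>ts. final x (q, ts)" for x
  proof -
    obtain p where "halts_within M (initial k x) (poly p (length x))"
      using polyM unfolding poly_time_iff k_def by blast
    then obtain q ts where c: "final x (q, ts)"
      using exists_halting_config unfolding final_def init_eq k_def by (metis surj_pair)
    then obtain n where "(init M x, (q, ts)) \<in> step M ^^ n" unfolding final_def rtrancl_power by blast
    then have "q \<in> states M" using wf_relpow_states[OF wfM] unfolding init_eq by fastforce
    with c show ?thesis by blast
  qed
  have resN: "ts \<in> results N (initial k x) \<longleftrightarrow> (\<exists>q \<in> states M. final x (q, ts))" for x ts
    unfolding N_def results_finish_tm[OF wfM subset_refl ok[unfolded k_def]] final_def init_eq k_def by blast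
  \<comment> \<open>The choice by \<open>SOME\<close> is determined: deterministic runs have at most
    one final configuration, and \<open>final_ex\<close> provides one.\<close>
  define word where "word x = tape_word (last (snd (SOME c. final x c)))" for x
  have word: "tape_word (last ts) = word x" if "final x (q, ts)" for x q ts
  proof -
    have "final x (SOME c. final x c)" using that by (rule someI)
    from final_unique[OF this that] show ?thesis unfolding word_def by simp
  qed
  define accepts where "accepts a x \<longleftrightarrow> accepting_configs (D a) x \<noteq> {}" for a x
  define f where "f x = accepts False x # accepts True x # word x" for x
  have "f \<in> NPSV_t"
    unfolding f_def
  proof (rule NPSV_t_decisions[where ?D0.0 = "\<lambda>b. verdict_tm b (D False)" and ?D1.0 = "\<lambda>b. verdict_tm b (D True)"
        and N = N and k = k and \<Gamma> = "alphabet M"])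
    have S: "{q \<in> states (D a). (q \<in> accepting (D a)) = b} \<subseteq> states (D a)" for a b by blast
    show "wf_tm (verdict_tm b (D False))" "wf_tm (verdict_tm b (D True))" for b
      unfolding verdict_tm_def using wf_finish_tm[OF wfD S] by auto
    show "poly_time (verdict_tm b (D False))" "poly_time (verdict_tm b (D True))" for b
      unfolding verdict_tm_def using poly_time_finish_tm[OF wfD S polyD] by auto
    show "wf_tm N" "poly_time N"
      unfolding N_def using wf_finish_tm[OF wfM subset_refl] poly_time_finish_tm[OF wfM subset_refl polyM] by auto
    have kD: "tapes (D a) = k" for a by (simp add: D_def k_def)
    show "results (verdict_tm b (D False)) (initial k x) \<noteq> {} \<longleftrightarrow> accepts False x = b"
      "results (verdict_tm b (D True)) (initial k x) \<noteq> {} \<longleftrightarrow> accepts True x = b" for b x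
      using results_verdict_tm[OF wfD polyD detD] unfolding accepts_def kD by blast+
    show "results N (initial k x) \<noteq> {}" for x using final_ex resN by blast
    show "tape_word (last ts) = word x" if "ts \<in> results N (initial k x)" for x ts
      using that resN word by blast
  qed (simp_all add: verdict_tm_def N_def D_def k_def)
  moreover have "\<exists>y \<alpha>. f x = encode_query y \<alpha> \<and> (x \<in> L \<longleftrightarrow> \<alpha> (y \<in> B))" for x
  proof (intro exI conjI)
    show "f x = encode_query (word x) (\<lambda>a. accepts a x)"
      unfolding f_def encode_query_def ..
    obtain q ts where c: "final x (q, ts)" using final_ex by blast
    show "x \<in> L \<longleftrightarrow> accepts (word x \<in> B) x"
      unfolding L accepts_def D_def
      using c word[OF c] by (intro oracle_accepts_iff[OF wf det one]) (auto simp: final_def)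
  qed
  ultimately show "L \<in> R_SN_1tt C"
    using B unfolding R_SN_1tt_def SN_1tt_reducible_def by blast
qed

theorem corollary3p6:
  "P_one_query NP \<subseteq> R_SN_1tt NP \<and> R_SN_1tt NP \<subseteq> DP"
  using P_one_query_subset_R_SN_1tt R_SN_1tt_NP_subset_DP by blast

end
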